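(* Let $k \geq 3$ be an integer and let $G$ be a $k$-connected graph with maximal local edge-connectivity $k$. Then $G$ is $k$-colourable if and only if $G$ is not a complete graph or an odd wheel (that is, $G$ is neither a complete graph nor an odd wheel).
   Context: All graphs are finite and simple. For distinct vertices $x,y$ of a graph, the local connectivity $\kappa(x,y)$ is the maximum number of internally vertex-disjoint paths between $x$ and $y$, and the local edge-connectivity $\lambda(x,y)$ is the maximum number of edge-disjoint paths between $x$ and $y$. A graph $G$ is $k$-connected if it has at least $2$ vertices and $\kappa(x,y)\geq k$ for all distinct $x,y\in V(G)$. A graph has maximal local edge-connectivity $k$ if $\lambda(x,y)\leq k$ for all pairs of distinct vertices $x,y$. An odd wheel is a graph obtained from a cycle of odd length by adding a vertex that is adjacent to every vertex of the cycle (in particular $K_4$ is an odd wheel). A graph is $k$-colourable if it has a proper vertex colouring with colours $\{1,\dots,k\}$. *)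

theory Defs
  imports "Graph_Theory.Graph_Theory"
begin

text \<open>
  Finite simple graphs are the \<open>pair_graph\<close>s of \<open>Graph_Theory\<close>: finite, loop-free, and
  with a symmetric arc relation, so that an edge \<open>{u, v}\<close> is present as both arcs
  \<open>(u, v)\<close> and \<open>(v, u)\<close>.
\<close>

definition paths_between :: "'a pair_pre_digraph \<Rightarrow> 'a \<Rightarrow> 'a \<Rightarrow> 'a vwalk set" where
  "paths_between G x y = {p. vpath p (with_proj G) \<and> hd p = x \<and> last p = y}"

text \<open>
  Edges are unordered, so that two paths traversing the same edge in opposite directions are
  not edge-disjoint.
\<close>

definition path_edges :: "'a vwalk \<Rightarrow> 'a set set" where
  "path_edges p = {{u, v} | u v. (u, v) \<in> set (vwalk_arcs p)}"

definition internally_disjoint_paths ::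
    "'a pair_pre_digraph \<Rightarrow> 'a \<Rightarrow> 'a \<Rightarrow> 'a vwalk set \<Rightarrow> bool" where
  "internally_disjoint_paths G x y P \<longleftrightarrow> P \<subseteq> paths_between G x y \<and>
     (\<forall>p\<in>P. \<forall>q\<in>P. p \<noteq> q \<longrightarrow> set p \<inter> set q \<subseteq> {x, y})"

definition edge_disjoint_paths ::
    "'a pair_pre_digraph \<Rightarrow> 'a \<Rightarrow> 'a \<Rightarrow> 'a vwalk set \<Rightarrow> bool" where
  "edge_disjoint_paths G x y P \<longleftrightarrow> P \<subseteq> paths_between G x y \<and>
     (\<forall>p\<in>P. \<forall>q\<in>P. p \<noteq> q \<longrightarrow> path_edges p \<inter> path_edges q = {})"

definition local_connectivity :: "'a pair_pre_digraph \<Rightarrow> 'a \<Rightarrow> 'a \<Rightarrow> nat" where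
  "local_connectivity G x y = Max (card ` {P. internally_disjoint_paths G x y P})"

definition local_edge_connectivity :: "'a pair_pre_digraph \<Rightarrow> 'a \<Rightarrow> 'a \<Rightarrow> nat" where
  "local_edge_connectivity G x y = Max (card ` {P. edge_disjoint_paths G x y P})"

text \<open>Both maxima range over finite non-empty sets when \<open>G\<close> is finite.\<close>

lemma finite_paths_between:
  assumes "finite (pverts G)"
  shows "finite (paths_between G x y)"
proof (rule finite_subset)
  show "paths_between G x y \<subseteq> {p. set p \<subseteq> pverts G \<and> length p \<le> card (pverts G)}"
    using assms by (auto simp: paths_between_def vpath_def vwalk_def
        simp flip: distinct_card intro: card_mono)
  show "finite {p. set p \<subseteq> pverts G \<and> length p \<le> card (pverts G)}"
    using assms by (rule finite_lists_length_le)
qed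

lemma finite_disjoint_path_families:
  assumes "finite (pverts G)"
  shows "finite {P. internally_disjoint_paths G x y P}"
    and "finite {P. edge_disjoint_paths G x y P}"
  by (rule finite_subset[of _ "Pow (paths_between G x y)"];
      auto simp: internally_disjoint_paths_def edge_disjoint_paths_def
        finite_paths_between[OF assms])+

lemma disjoint_path_families_nonempty:
  "{P. internally_disjoint_paths G x y P} \<noteq> {}" "{P. edge_disjoint_paths G x y P} \<noteq> {}"
  by (auto simp: internally_disjoint_paths_def edge_disjoint_paths_def intro!: exI[of _ "{}"])

definition k_connected :: "nat \<Rightarrow> 'a pair_pre_digraph \<Rightarrow> bool" where
  "k_connected k G \<longleftrightarrow> card (pverts G) \<ge> 2 \<and>
     (\<forall>x\<in>pverts G. \<forall>y\<in>pverts G. x \<noteq> y \<longrightarrow> local_connectivity G x y \<ge> k)"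

definition maximal_local_edge_connectivity :: "nat \<Rightarrow> 'a pair_pre_digraph \<Rightarrow> bool" where
  "maximal_local_edge_connectivity k G \<longleftrightarrow>
     (\<forall>x\<in>pverts G. \<forall>y\<in>pverts G. x \<noteq> y \<longrightarrow> local_edge_connectivity G x y \<le> k)"

definition complete_graph :: "'a pair_pre_digraph \<Rightarrow> bool" where
  "complete_graph G \<longleftrightarrow> (\<exists>n. complete_digraph n (with_proj G))"

text \<open>
  The list \<open>c\<close> gives the vertices of the rim in cyclic order, and \<open>h\<close> is the hub; \<open>symcl\<close>
  is the symmetric closure.
\<close>

definition odd_wheel :: "'a pair_pre_digraph \<Rightarrow> bool" where
  "odd_wheel G \<longleftrightarrow> (\<exists>c h. distinct c \<and> length c \<ge> 3 \<and> odd (length c) \<and> h \<notin> set c \<and>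
     pverts G = insert h (set c) \<and>
     parcs G = symcl (set (zip c (rotate1 c)) \<union> {h} \<times> set c))"

definition k_colourable :: "nat \<Rightarrow> 'a pair_pre_digraph \<Rightarrow> bool" where
  "k_colourable k G \<longleftrightarrow> (\<exists>f :: 'a \<Rightarrow> nat. f ` pverts G \<subseteq> {1..k} \<and>
     (\<forall>(u, v)\<in>parcs G. f u \<noteq> f v))"

end

theory Submission
  imports Defs
begin

text \<open>
  Call a vertex big if its degree exceeds \<open>k\<close>. By Menger's theorem for edges, two big vertices are
  separated by at most \<open>k\<close> edges, and \<open>k\<close>-connectedness forces these edges to form a matching of
  size \<open>k\<close> between two sides with more than \<open>k\<close> vertices each. Replacing either side by a clique on
  its \<open>k\<close> matched vertices gives a smaller graph of the same kind without universal vertex, hence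
  \<open>k\<close>-colourable by induction. As the clique uses every colour, the ends of the matching on the
  other side do not all have the same colour. So neither of the two partial colourings is constant on
  the ends of the matching, and then some permutation of the colours makes them compatible.

  If there is at most one big vertex \<open>h\<close> and it has a non-neighbour, then there is a path \<open>h v w\<close>
  with \<open>h\<close> and \<open>w\<close> non-adjacent; as in Brooks' theorem, colour \<open>h\<close> and \<open>w\<close> alike and the rest greedily
  towards \<open>v\<close>. If \<open>h\<close> is universal, the same argument colours \<open>G - h\<close> with \<open>k - 1\<close> colours when
  \<open>k \<ge> 4\<close> and \<open>G\<close> is not complete, while for \<open>k = 3\<close> the graph \<open>G - h\<close> is a cycle.
\<close>

section \<open>The edge version of Menger's theorem\<close>

definition flux :: "'a rel \<Rightarrow> 'a \<Rightarrow> int" where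
  "flux F v = int (card (F `` {v})) - int (card (F\<inverse> `` {v}))"

lemma flux_empty [simp]: "flux {} v = 0"
  by (simp add: flux_def)

lemma flux_insert:
  assumes "finite F" "(u, v) \<notin> F"
  shows "flux (insert (u, v) F) w = flux F w + of_bool (w = u) - of_bool (w = v)"
proof -
  have fin: "finite (F `` {w})" "finite (F\<inverse> `` {w})"
    using assms(1) by (auto intro: finite_Image)
  have "insert (u, v) F `` {w} = (if w = u then insert v (F `` {w}) else F `` {w})"
    "(insert (u, v) F)\<inverse> `` {w} = (if w = v then insert u (F\<inverse> `` {w}) else F\<inverse> `` {w})"
    by auto
  then show ?thesis
    using fin assms(2) by (auto simp: flux_def card_insert_if)
qed

lemma flux_remove:
  assumes "finite F" "(u, v) \<in> F"
  shows "flux (F - {(u, v)}) w = flux F w - of_bool (w = u) + of_bool (w = v)"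
  using flux_insert[of "F - {(u, v)}" u v w] assms by (simp add: insert_absorb)

text \<open>Arcs with both ends in \<open>X\<close> cancel in the sum, so only those crossing the
  boundary count.\<close>

lemma sum_flux:
  assumes "finite F" "finite X"
  shows "(\<Sum>v\<in>X. flux F v) = int (card (F \<inter> X \<times> - X)) - int (card (F \<inter> (- X) \<times> X))"
  using assms(1)
proof (induction F)
  case (insert e F)
  obtain u v where e: "e = (u, v)" by fastforce
  have "(\<Sum>w\<in>X. flux (insert e F) w)
      = (\<Sum>w\<in>X. flux F w) + (\<Sum>w\<in>X. of_bool (w = u)) - (\<Sum>w\<in>X. of_bool (w = v))"
    using insert by (simp add: e flux_insert sum.distrib sum_subtractf)
  also have "\<dots> = (\<Sum>w\<in>X. flux F w) + of_bool (u \<in> X) - of_bool (v \<in> X)"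
    using assms(2) by (simp add: of_bool_def sum.delta)
  finally show ?case
    using insert by (auto simp: e Int_insert_left)
qed simp

lemma flux_remove_walk:
  assumes "finite F" "distinct p" "p \<noteq> []" "set (vwalk_arcs p) \<subseteq> F"
  shows "flux (F - set (vwalk_arcs p)) w = flux F w - of_bool (w = hd p) + of_bool (w = last p)"
  using assms(2-4)
proof (induction p rule: vwalk_arcs.induct)
  case (3 x y xs)
  let ?A = "set (vwalk_arcs (y # xs))"
  have "(x, y) \<notin> ?A"
    using "3.prems"(1) by (meson distinct.simps(2) in_set_vwalk_arcsE)
  moreover have "F - set (vwalk_arcs (x # y # xs)) = (F - ?A) - {(x, y)}"
    by auto
  ultimately show ?case
    using 3 assms(1) by (subst \<open>F - _ = _\<close>, subst flux_remove) auto
qed auto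

lemma augment_along_path:
  assumes "finite E" "sym E" "F \<subseteq> E" "asym F"
    and "distinct p" "p \<noteq> []" "set (vwalk_arcs p) \<subseteq> E - F"
  shows "\<exists>F'\<subseteq>E. asym F' \<and> (\<forall>w. flux F' w = flux F w + of_bool (w = hd p) - of_bool (w = last p))"
  using assms(3-7)
proof (induction p arbitrary: F rule: vwalk_arcs.induct)
  case (3 x y xs)
  \<comment> \<open>If the reverse arc is in use it is cancelled, otherwise \<open>(x, y)\<close> is
    added: both change the flux alike, and \<open>F1\<close> stays antisymmetric. The later arcs
    stay outside \<open>F1\<close> because \<open>x\<close> does not recur on the path.\<close>
  define F1 where "F1 = (if (y, x) \<in> F then F - {(y, x)} else insert (x, y) F)"
  let ?A = "set (vwalk_arcs (y # xs))"
  have fin: "finite F" using "3.prems"(1) assms(1) finite_subset by blast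
  have xy: "x \<noteq> y" "(x, y) \<in> E" "(x, y) \<notin> F" using "3.prems" by auto
  have "(x, y) \<notin> ?A" "(y, x) \<notin> ?A"
    using "3.prems"(3) by (meson distinct.simps(2) in_set_vwalk_arcsE)+
  then have A: "?A \<subseteq> E - F1"
    using "3.prems"(5) by (auto simp: F1_def)
  have F1: "F1 \<subseteq> E" "asym F1"
    using "3.prems"(1,2) xy by (auto simp: F1_def asym_iff)
  obtain F' where F': "F' \<subseteq> E" "asym F'"
    "\<And>w. flux F' w = flux F1 w + of_bool (w = y) - of_bool (w = last (y # xs))"
    using "3.IH"[OF F1 _ _ A] "3.prems"(3) by auto
  have "flux F1 w = flux F w + of_bool (w = x) - of_bool (w = y)" for w
    using flux_insert[OF fin xy(3), of w] flux_remove[OF fin, of y x w] by (auto simp: F1_def)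
  then show ?case using F' by (intro exI[of _ F']) auto
qed auto

definition path_in :: "'a rel \<Rightarrow> 'a \<Rightarrow> 'a \<Rightarrow> 'a list \<Rightarrow> bool" where
  "path_in R s t p \<longleftrightarrow> p \<noteq> [] \<and> distinct p \<and> hd p = s \<and> last p = t \<and> set (vwalk_arcs p) \<subseteq> R"

lemma rtrancl_imp_path:
  assumes "(s, t) \<in> R\<^sup>*"
  shows "\<exists>p. path_in R s t p"
  using assms unfolding path_in_def
proof (induction rule: converse_rtrancl_induct)
  case base
  show ?case by (intro exI[of _ "[t]"]) auto
next
  case (step y z)
  then obtain p where p: "p \<noteq> []" "distinct p" "hd p = z" "last p = t" "set (vwalk_arcs p) \<subseteq> R"
    by blast
  show ?case
  proof (cases "y \<in> set p")
    case True
    then obtain p1 p2 where "p = p1 @ y # p2" by (meson split_list)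
    with p show ?thesis
      using set_vwalk_arcs_append2[of "y # p2" p1] by (intro exI[of _ "y # p2"]) auto
  next
    case False
    with p step.hyps show ?thesis by (intro exI[of _ "y # p"]) auto
  qed
qed

text \<open>
  Unit flows are antisymmetric sets of arcs, so that the arcs outside \<open>F\<close> are exactly those of
  the residual graph: pushing along \<open>(u, v)\<close> cancels \<open>(v, u)\<close> if that arc is in use.
\<close>

definition flow :: "'a rel \<Rightarrow> 'a \<Rightarrow> 'a \<Rightarrow> nat \<Rightarrow> 'a rel \<Rightarrow> bool" where
  "flow E s t m F \<longleftrightarrow> F \<subseteq> E \<and> asym F \<and>
     (\<forall>w. flux F w = int m * (of_bool (w = s) - of_bool (w = t)))"

text \<open>Ford-Fulkerson: a flow of value \<open>n < m\<close> has an augmenting path, for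
  otherwise some cut would consist of only \<open>n\<close> edges.\<close>

lemma flow_exists:
  assumes "finite V" "E \<subseteq> V \<times> V" "sym E" "s \<in> V" "s \<noteq> t"
    and cuts: "\<And>X. X \<subseteq> V \<Longrightarrow> s \<in> X \<Longrightarrow> t \<notin> X \<Longrightarrow> m \<le> card (E \<inter> X \<times> - X)"
  shows "\<exists>F. flow E s t m F"
proof -
  have finE: "finite E" using assms(1,2) by (meson finite_SigmaI finite_subset)
  have "\<exists>F. flow E s t n F" if "n \<le> m" for n
    using that
  proof (induction n)
    case 0
    show ?case by (intro exI[of _ "{}"]) (auto simp: flow_def asym_iff)
  next
    case (Suc n)
    then obtain F where F: "F \<subseteq> E" "asym F"
      "\<And>w. flux F w = int n * (of_bool (w = s) - of_bool (w = t))"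
      by (auto simp: flow_def)
    have finF: "finite F" using F(1) finE finite_subset by blast
    have "(s, t) \<in> (E - F)\<^sup>*"
    proof (rule ccontr)
      assume unreach: "(s, t) \<notin> (E - F)\<^sup>*"
      \<comment> \<open>No residual arc leaves the set reachable from \<open>s\<close>, so every
        edge leaving it carries flow and no flow enters it. Its cut then has exactly
        \<open>n\<close> edges.\<close>
      define X where "X = (E - F)\<^sup>* `` {s}"
      have "v \<in> V" if "(s, v) \<in> (E - F)\<^sup>*" for v
        using that assms(2,4) by (induction rule: rtrancl_induct) auto
      then have X: "X \<subseteq> V" "s \<in> X" "t \<notin> X" using unreach by (auto simp: X_def)
      then have finX: "finite X" using assms(1) finite_subset by blast
      have step: "b \<in> X" if "a \<in> X" "(a, b) \<in> E" "(a, b) \<notin> F" for a b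
        using that unfolding X_def by (auto intro: rtrancl_into_rtrancl)
      have out: "F \<inter> X \<times> - X = E \<inter> X \<times> - X" using step F(1) by blast
      have inn: "F \<inter> (- X) \<times> X = {}"
      proof (rule ccontr)
        assume "F \<inter> (- X) \<times> X \<noteq> {}"
        then obtain a b where ab: "(a, b) \<in> F" "a \<notin> X" "b \<in> X" by auto
        then have "(b, a) \<in> E" "(b, a) \<notin> F"
          using F(1,2) assms(3) by (auto simp: asym_iff dest: symD)
        with step ab show False by blast
      qed
      have "int (card (E \<inter> X \<times> - X)) = (\<Sum>v\<in>X. flux F v)"
        using sum_flux[OF finF finX] out inn by simp
      also have "\<dots> = int n"
        using X finX by (simp add: F(3) sum_distrib_left[symmetric] sum_subtractf of_bool_def sum.delta)
      finally show False using cuts[OF X] Suc.prems by simp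
    qed
    from rtrancl_imp_path[OF this]
    obtain p where p: "p \<noteq> []" "distinct p" "hd p = s" "last p = t"
      "set (vwalk_arcs p) \<subseteq> E - F"
      unfolding path_in_def by (elim exE conjE)
    obtain F' where "F' \<subseteq> E" "asym F'"
      "\<And>w. flux F' w = flux F w + of_bool (w = s) - of_bool (w = t)"
      using augment_along_path[OF finE assms(3) F(1,2) p(2,1,5)] p(3,4) by auto
    then show ?case by (intro exI[of _ F']) (auto simp: flow_def F(3) algebra_simps)
  qed
  then show ?thesis by blast
qed

text \<open>While the value is positive, \<open>F\<close> contains a path from \<open>s\<close> to
  \<open>t\<close>: otherwise the set reachable from \<open>s\<close> would have positive net
  outflow but no leaving arc. Removing the path lowers the value by one; arcs left over at value 0
  are ignored.\<close>

lemma flow_decomposition: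
  assumes "finite V" "F \<subseteq> V \<times> V" "s \<in> V" "s \<noteq> t"
    and "\<And>w. flux F w = int m * (of_bool (w = s) - of_bool (w = t))"
  shows "\<exists>P. finite P \<and> card P = m \<and>
    (\<forall>p\<in>P. path_in F s t p) \<and>
    (\<forall>p\<in>P. \<forall>q\<in>P. p \<noteq> q \<longrightarrow> set (vwalk_arcs p) \<inter> set (vwalk_arcs q) = {})"
  using assms(2,5)
proof (induction m arbitrary: F)
  case 0
  show ?case by (intro exI[of _ "{}"]) auto
next
  case (Suc m)
  have finF: "finite F" using assms(1) Suc.prems(1) by (meson finite_SigmaI finite_subset)
  have "(s, t) \<in> F\<^sup>*"
  proof (rule ccontr)
    assume unreach: "(s, t) \<notin> F\<^sup>*"
    define X where "X = F\<^sup>* `` {s}"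
    have "v \<in> V" if "(s, v) \<in> F\<^sup>*" for v
      using that Suc.prems(1) assms(3) by (induction rule: rtrancl_induct) auto
    then have X: "X \<subseteq> V" "s \<in> X" "t \<notin> X" using unreach by (auto simp: X_def)
    then have finX: "finite X" using assms(1) finite_subset by blast
    have "F \<inter> X \<times> - X = {}" unfolding X_def by (auto intro: rtrancl_into_rtrancl)
    then have "(\<Sum>v\<in>X. flux F v) \<le> 0"
      using sum_flux[OF finF finX] by simp
    moreover have "(\<Sum>v\<in>X. flux F v) = int (Suc m)"
      using X finX by (simp add: Suc.prems(2) sum_distrib_left[symmetric] sum_subtractf of_bool_def sum.delta del: of_nat_Suc)
    ultimately show False by simp
  qed
  from rtrancl_imp_path[OF this]
  obtain p where p_path: "path_in F s t p"
    by (elim exE)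
  then have p: "p \<noteq> []" "distinct p" "hd p = s" "last p = t" "set (vwalk_arcs p) \<subseteq> F"
    by (auto simp: path_in_def)
  define F' where "F' = F - set (vwalk_arcs p)"
  have sub: "F' \<subseteq> V \<times> V" using Suc.prems(1) by (auto simp: F'_def)
  have "flux F' w = int m * (of_bool (w = s) - of_bool (w = t))" for w
    unfolding F'_def using flux_remove_walk[OF finF p(2,1,5), of w] p(3,4)
    by (simp add: Suc.prems(2) algebra_simps)
  from Suc.IH[OF sub this]
  obtain P where P: "finite P" "card P = m" "\<forall>q\<in>P. path_in F' s t q"
    "\<forall>q\<in>P. \<forall>r\<in>P. q \<noteq> r \<longrightarrow> set (vwalk_arcs q) \<inter> set (vwalk_arcs r) = {}"
    by (elim exE conjE)
  have disj: "set (vwalk_arcs p) \<inter> set (vwalk_arcs q) = {}" if "q \<in> P" for q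
    using P(3) that by (auto simp: F'_def path_in_def)
  \<comment> \<open>As \<open>s \<noteq> t\<close>, \<open>p\<close> has an arc and so is not
    arc-disjoint from itself; hence it is new to \<open>P\<close> and the count goes up.\<close>
  have "set (vwalk_arcs p) \<noteq> {}"
    using p assms(4) by (cases p rule: vwalk_arcs.cases) auto
  then have "p \<notin> P" using disj[of p] by auto
  moreover have "path_in F s t q" if "q \<in> P" for q
    using P(3) that by (auto simp: F'_def path_in_def)
  ultimately show ?case
    using P(1,2,4) p_path disj by (intro exI[of _ "insert p P"]) (simp add: Int_commute)
qed

text \<open>If every separating cut had more than \<open>k\<close> edges, a flow of value
  \<open>k + 1\<close> would decompose into \<open>k + 1\<close> edge-disjoint paths.\<close>

lemma small_edge_cut:
  assumes "pair_graph G" "x \<in> pverts G" "x \<noteq> y" "local_edge_connectivity G x y \<le> k"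
  shows "\<exists>U\<subseteq>pverts G. x \<in> U \<and> y \<notin> U \<and> card (parcs G \<inter> U \<times> - U) \<le> k"
proof (rule ccontr)
  assume no_cut: "\<not> ?thesis"
  interpret pair_graph G by fact
  have sub: "parcs G \<subseteq> pverts G \<times> pverts G" by (auto dest: in_arcsD1 in_arcsD2)
  have "\<exists>F. flow (parcs G) x y (Suc k) F"
  proof (rule flow_exists[OF pair_finite_verts sub _ assms(2,3)])
    show "sym (parcs G)" using pair_sym_arcs by (simp add: symmetric_def)
  qed (use no_cut in \<open>auto simp: not_less_eq_eq\<close>)
  then obtain F where F: "F \<subseteq> parcs G" "asym F"
    "\<And>w. flux F w = int (Suc k) * (of_bool (w = x) - of_bool (w = y))"
    by (auto simp: flow_def)
  have "F \<subseteq> pverts G \<times> pverts G" using F(1) sub by blast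
  from flow_decomposition[OF pair_finite_verts this assms(2,3) F(3)]
  obtain P where P: "finite P" "card P = Suc k" "\<forall>q\<in>P. path_in F x y q"
    "\<forall>q\<in>P. \<forall>r\<in>P. q \<noteq> r \<longrightarrow> set (vwalk_arcs q) \<inter> set (vwalk_arcs r) = {}"
    by (elim exE conjE)
  have verts: "set q \<subseteq> pverts G" if "q \<noteq> []" "hd q = x" "set (vwalk_arcs q) \<subseteq> parcs G" for q
    using that assms(2)
  proof (induction q arbitrary: x rule: vwalk_arcs.induct)
    case (3 a b q)
    then show ?case using in_arcsD2 by auto
  qed auto
  have "edge_disjoint_paths G x y P"
    unfolding edge_disjoint_paths_def
  proof (intro conjI ballI impI subsetI)
    fix q assume "q \<in> P"
    then show "q \<in> paths_between G x y"
      using P(3) F(1) verts[of q] by (auto simp: path_in_def paths_between_def vpath_def vwalk_def)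
  next
    fix q r assume qr: "q \<in> P" "r \<in> P" "q \<noteq> r"
    show "path_edges q \<inter> path_edges r = {}"
    proof (rule ccontr)
      assume "path_edges q \<inter> path_edges r \<noteq> {}"
      then obtain u v u' v' where uv: "(u, v) \<in> set (vwalk_arcs q)" "(u', v') \<in> set (vwalk_arcs r)"
        "{u, v} = {u', v'}" by (auto simp: path_edges_def)
      \<comment> \<open>Arc-disjoint paths can share an edge only in opposite directions, which
        antisymmetry of the flow forbids.\<close>
      moreover have "(u, v) \<noteq> (u', v')" using P(4) qr uv by blast
      ultimately have "(v, u) \<in> F" "(u, v) \<in> F"
        using P(3) qr uv(1,2) by (auto simp: path_in_def doubleton_eq_iff)
      then show False using F(2) by (auto simp: asym_iff)
    qed
  qed
  then have "Suc k \<le> local_edge_connectivity G x y"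
    unfolding local_edge_connectivity_def
    using finite_disjoint_path_families(2)[OF pair_finite_verts, of x y] P(2)
    by (intro Max_ge) (auto intro!: rev_image_eqI)
  with assms(4) show False by simp
qed

section \<open>Connectivity in terms of cuts\<close>

text \<open>Connectedness of the subgraph induced on \<open>W\<close>, in the cut form that the
  separator and greedy arguments use directly. The empty set and singletons count as
  connected.\<close>

definition conn :: "'a rel \<Rightarrow> 'a set \<Rightarrow> bool" where
  "conn E W \<longleftrightarrow> (\<forall>A\<subseteq>W. A \<noteq> {} \<longrightarrow> A \<noteq> W \<longrightarrow> (\<exists>a\<in>A. \<exists>b\<in>W - A. (a, b) \<in> E))"

lemma connE:
  assumes "conn E W" "A \<subseteq> W" "A \<noteq> {}" "A \<noteq> W"
  obtains a b where "a \<in> A" "b \<in> W" "b \<notin> A" "(a, b) \<in> E"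
  using assms unfolding conn_def by blast

lemma paths_betweenD:
  assumes "p \<in> paths_between G x y"
  shows "distinct p" "p \<noteq> []" "hd p = x" "last p = y" "set p \<subseteq> pverts G"
    "set (vwalk_arcs p) \<subseteq> parcs G"
  using assms by (auto simp: paths_between_def vpath_def vwalk_def)

section \<open>Degrees and separators from internally disjoint paths\<close>

lemma local_connectivity_witness:
  assumes "finite (pverts G)" "k \<le> local_connectivity G x y"
  obtains P where "internally_disjoint_paths G x y P" "k \<le> card P" "finite P"
proof -
  have "local_connectivity G x y \<in> card ` {P. internally_disjoint_paths G x y P}"
    unfolding local_connectivity_def
    using finite_disjoint_path_families(1)[OF assms(1)] disjoint_path_families_nonempty(1)
    by (intro Max_in) auto
  then obtain P where P: "internally_disjoint_paths G x y P" "k \<le> card P"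
    using assms(2) by auto
  moreover have "finite P"
    using P(1) finite_paths_between[OF assms(1)] finite_subset
    unfolding internally_disjoint_paths_def by blast
  ultimately show thesis using that by blast
qed

text \<open>The second vertices of internally disjoint paths are distinct neighbours of
  \<open>x\<close>: a shared one could only be \<open>y\<close>, and then both paths are the single
  edge.\<close>

lemma degree_ge_local_connectivity:
  assumes "pair_graph G" "x \<noteq> y" "k \<le> local_connectivity G x y"
  shows "k \<le> card (parcs G `` {x})"
proof -
  interpret pair_graph G by fact
  obtain P where P: "internally_disjoint_paths G x y P" "k \<le> card P" "finite P"
    using local_connectivity_witness[OF pair_finite_verts assms(3)] .
  have shape: "\<exists>z r. p = x # z # r \<and> (x, z) \<in> parcs G \<and> z \<noteq> x \<and> (z = y \<longrightarrow> r = [])"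
    if "p \<in> P" for p
  proof -
    have "p \<in> paths_between G x y"
      using that P(1) by (auto simp: internally_disjoint_paths_def)
    note p = paths_betweenD[OF this]
    show ?thesis
      using p assms(2) by (cases p rule: vwalk_arcs.cases) (auto split: if_splits)
  qed
  have "inj_on (\<lambda>p. p ! 1) P"
  proof (rule inj_onI, rule ccontr)
    fix p q assume pq: "p \<in> P" "q \<in> P" "p ! 1 = q ! 1" "p \<noteq> q"
    obtain z r where p: "p = x # z # r" "z \<noteq> x" "z = y \<longrightarrow> r = []" using shape[OF pq(1)] by blast
    obtain z' r' where q: "q = x # z' # r'" "z' = y \<longrightarrow> r' = []" using shape[OF pq(2)] by blast
    have "z' = z" using pq(3) p(1) q(1) by simp
    moreover have "set p \<inter> set q \<subseteq> {x, y}"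
      using P(1) pq by (auto simp: internally_disjoint_paths_def)
    ultimately show False using p q pq(4) by auto
  qed
  moreover have "(\<lambda>p. p ! 1) ` P \<subseteq> parcs G `` {x}"
  proof (rule image_subsetI)
    fix p assume "p \<in> P"
    from shape[OF this] show "p ! 1 \<in> parcs G `` {x}" by auto
  qed
  moreover have "finite (parcs G `` {x})" using pair_finite_arcs by (rule finite_Image)
  ultimately have "card P \<le> card (parcs G `` {x})" by (rule card_inj_on_le)
  then show ?thesis using P(2) by simp
qed

lemma walk_stays:
  assumes "p \<noteq> []" "hd p \<in> A" "set p \<subseteq> W" "set (vwalk_arcs p) \<subseteq> E"
    and "\<And>a b. a \<in> A \<Longrightarrow> b \<in> W \<Longrightarrow> (a, b) \<in> E \<Longrightarrow> b \<in> A"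
  shows "set p \<subseteq> A"
  using assms(1-4)
proof (induction p rule: vwalk_arcs.induct)
  case (3 a b p)
  then have "b \<in> A" using assms(5)[of a b] by auto
  then show ?case using 3 by auto
qed auto

text \<open>If no edge joined \<open>A\<close> to the rest of the graph minus \<open>S\<close>, each
  of \<open>k\<close> internally disjoint paths from \<open>A\<close> to that rest would meet
  \<open>S\<close>. The meeting points differ from the ends, hence are distinct, against
  \<open>card S < k\<close>.\<close>

lemma conn_if_k_connected:
  assumes "pair_graph G" "k_connected k G" "S \<subseteq> pverts G" "card S < k"
  shows "conn (parcs G) (pverts G - S)"
proof (rule ccontr)
  assume "\<not> ?thesis"
  then obtain A where A: "A \<subseteq> pverts G - S" "A \<noteq> {}" "A \<noteq> pverts G - S"
    "\<And>a b. a \<in> A \<Longrightarrow> b \<in> pverts G - S \<Longrightarrow> (a, b) \<in> parcs G \<Longrightarrow> b \<in> A"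
    unfolding conn_def by blast
  interpret pair_graph G by fact
  obtain x y where xy: "x \<in> A" "y \<in> pverts G - S" "y \<notin> A" using A(1-3) by blast
  then have "k \<le> local_connectivity G x y"
    using assms(2) A(1) by (auto simp: k_connected_def)
  then obtain P where P: "internally_disjoint_paths G x y P" "k \<le> card P" "finite P"
    using local_connectivity_witness[OF pair_finite_verts] by metis
  have "\<exists>z. z \<in> set p \<inter> S" if "p \<in> P" for p
  proof (rule ccontr)
    assume none: "\<nexists>z. z \<in> set p \<inter> S"
    have "p \<in> paths_between G x y"
      using that P(1) by (auto simp: internally_disjoint_paths_def)
    note p = paths_betweenD[OF this]
    have "set p \<subseteq> A"
      by (rule walk_stays[OF p(2) _ _ p(6), of _ "pverts G - S"]) (use p(3,5) none xy(1) A(4) in auto)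
    then show False using p(2,4) xy(3) last_in_set[OF p(2)] by auto
  qed
  then obtain z where z: "\<And>p. p \<in> P \<Longrightarrow> z p \<in> set p \<inter> S" by metis
  have "inj_on z P"
  proof (rule inj_onI, rule ccontr)
    fix p q assume pq: "p \<in> P" "q \<in> P" "z p = z q" "p \<noteq> q"
    have "set p \<inter> set q \<subseteq> {x, y}"
      using P(1) pq by (auto simp: internally_disjoint_paths_def)
    then have "z p \<in> {x, y}" using z[OF pq(1)] z[OF pq(2)] pq(3) by auto
    then show False using z[OF pq(1)] xy A(1) by auto
  qed
  moreover have "z ` P \<subseteq> S" using z by auto
  moreover have "finite S" using assms(3) pair_finite_verts finite_subset by blast
  ultimately have "card P \<le> card S" by (rule card_inj_on_le)
  then show False using P(2) assms(4) by simp
qed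

locale fin_sgraph =
  fixes V :: "'a set" and E :: "'a rel"
  assumes fin_V: "finite V" and E_sub: "E \<subseteq> V \<times> V" and sym_E: "sym E" and irrefl_E: "irrefl E"

text \<open>
  The consequences of the two connectivity hypotheses that survive the reduction; unlike the
  hypotheses themselves, they mention no paths.
\<close>

definition tight :: "nat \<Rightarrow> 'a set \<Rightarrow> 'a rel \<Rightarrow> bool" where
  "tight k V E \<longleftrightarrow> (\<forall>v\<in>V. k \<le> card (E `` {v})) \<and>
     (\<forall>S\<subseteq>V. card S < k \<longrightarrow> conn E (V - S)) \<and>
     (\<forall>x\<in>V. \<forall>y\<in>V. x \<noteq> y \<longrightarrow> k < card (E `` {x}) \<longrightarrow> k < card (E `` {y}) \<longrightarrow>
        (\<exists>U\<subseteq>V. (x \<in> U) \<noteq> (y \<in> U) \<and> card (E \<inter> U \<times> - U) \<le> k))"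

lemma tightD:
  assumes "tight k V E"
  shows "v \<in> V \<Longrightarrow> k \<le> card (E `` {v})"
    and "S \<subseteq> V \<Longrightarrow> card S < k \<Longrightarrow> conn E (V - S)"
    and "x \<in> V \<Longrightarrow> y \<in> V \<Longrightarrow> x \<noteq> y \<Longrightarrow> k < card (E `` {x}) \<Longrightarrow> k < card (E `` {y}) \<Longrightarrow>
        \<exists>U\<subseteq>V. (x \<in> U) \<noteq> (y \<in> U) \<and> card (E \<inter> U \<times> - U) \<le> k"
  using assms by (simp_all add: tight_def)

lemma fin_sgraph_pair_graph:
  assumes "pair_graph G"
  shows "fin_sgraph (pverts G) (parcs G)"
proof -
  interpret pair_graph G by fact
  show ?thesis
  proof
    show "irrefl (parcs G)" using pair_no_loops by (fastforce simp: irrefl_def)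
  qed (use pair_finite_verts pair_sym_arcs in
      \<open>auto simp: symmetric_def dest: in_arcsD1 in_arcsD2\<close>)
qed

lemma tight_pair_graph:
  assumes "pair_graph G" "k_connected k G" "maximal_local_edge_connectivity k G"
  shows "tight k (pverts G) (parcs G)"
  unfolding tight_def
proof (intro conjI ballI allI impI)
  fix v assume v: "v \<in> pverts G"
  have "card (pverts G) \<ge> 2" using assms(2) by (simp add: k_connected_def)
  then have "pverts G \<noteq> {v}" by auto
  then obtain y where "y \<in> pverts G" "y \<noteq> v" using v by blast
  then show "k \<le> card (parcs G `` {v})"
    using degree_ge_local_connectivity[OF assms(1), of v y k] assms(2) v by (auto simp: k_connected_def)
next
  fix S assume "S \<subseteq> pverts G" "card S < k"
  then show "conn (parcs G) (pverts G - S)" using conn_if_k_connected[OF assms(1,2)] by blast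
next
  fix x y assume xy: "x \<in> pverts G" "y \<in> pverts G" "x \<noteq> y"
  then have "local_edge_connectivity G x y \<le> k"
    using assms(3) by (simp add: maximal_local_edge_connectivity_def)
  from small_edge_cut[OF assms(1) xy(1,3) this]
  show "\<exists>U\<subseteq>pverts G. (x \<in> U) \<noteq> (y \<in> U) \<and> card (parcs G \<inter> U \<times> - U) \<le> k" by blast
qed

section \<open>Colourings\<close>

lemma permutation_avoiding:
  fixes f g :: "'i \<Rightarrow> nat"
  assumes "finite I" "card I \<le> k"
    and "\<And>i. i \<in> I \<Longrightarrow> f i < k" "\<And>i. i \<in> I \<Longrightarrow> g i < k"
    and "i1 \<in> I" "i2 \<in> I" "f i1 \<noteq> f i2" "g i1 \<noteq> g i2"
  shows "\<exists>\<pi>. inj_on \<pi> {..<k} \<and> \<pi> ` {..<k} \<subseteq> {..<k} \<and> (\<forall>i\<in>I. \<pi> (f i) \<noteq> g i)"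
proof -
  \<comment> \<open>Among the \<open>k\<close> cyclic shifts of a bijection, each \<open>i\<close> rules out exactly one. The bijection
     \<open>\<sigma>\<close> is chosen so that \<open>i1\<close> and \<open>i2\<close> rule out the same one.\<close>
  define \<tau> where "\<tau> = Transposition.transpose (f i1) (g i1)"
  define \<sigma> where "\<sigma> = Transposition.transpose (\<tau> (f i2)) (g i2) \<circ> \<tau>"
  have inj_\<sigma>: "inj \<sigma>"
    unfolding \<sigma>_def \<tau>_def by (intro inj_compose inj_transpose)
  have \<tau>_lt: "\<tau> c < k" if "c < k" for c
    using that assms(3,4)[OF assms(5)] by (auto simp: \<tau>_def Transposition.transpose_def)
  have \<sigma>_lt: "\<sigma> c < k" if "c < k" for c
    using \<tau>_lt[OF that] \<tau>_lt[OF assms(3)[OF assms(6)]] assms(4)[OF assms(6)]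
    by (auto simp: \<sigma>_def Transposition.transpose_def)
  \<comment> \<open>The second transposition moves only \<open>\<tau> (f i2)\<close> and
    \<open>g i2\<close>, both different from \<open>g i1\<close>, so it does not disturb what the
    first one achieved.\<close>
  have \<sigma>1: "\<sigma> (f i1) = g i1" and \<sigma>2: "\<sigma> (f i2) = g i2"
    using assms(7,8) by (auto simp: \<sigma>_def \<tau>_def Transposition.transpose_def)
  \<comment> \<open>\<open>s i\<close> is the only shift that sends \<open>f i\<close> to
    \<open>g i\<close>. The inner subtraction does not truncate, as
    \<open>\<sigma> (f i) < k\<close>.\<close>
  define s where "s i = (g i + (k - \<sigma> (f i))) mod k" for i
  have "s i1 = 0" "s i2 = 0"
    using \<sigma>1 \<sigma>2 assms(4)[OF assms(5)] assms(4)[OF assms(6)] by (simp_all add: s_def)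
  moreover have "i2 \<in> I - {i1}" using assms(6,7) by auto
  ultimately have "s i1 \<in> s ` (I - {i1})" by (intro image_eqI[of _ _ i2]) simp_all
  then have "s ` I = s ` (I - {i1})" by blast
  then have "card (s ` I) \<le> card (I - {i1})"
    using card_image_le[of "I - {i1}" s] assms(1) by simp
  also have "\<dots> < k"
    using assms(1,2,5) by (metis card_Diff1_less less_le_trans)
  finally have "\<not> {..<k} \<subseteq> s ` I"
    using card_mono[of "s ` I" "{..<k}"] assms(1) by auto
  then obtain t where t: "t < k" "t \<notin> s ` I" by blast
  define \<pi> where "\<pi> c = (\<sigma> c + t) mod k" for c
  have \<pi>_inv: "(\<pi> c + (k - t)) mod k = \<sigma> c" if "c < k" for c
  proof -
    have "(\<pi> c + (k - t)) mod k = (\<sigma> c + t + (k - t)) mod k"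
      unfolding \<pi>_def by (rule mod_add_left_eq)
    then show ?thesis using \<sigma>_lt[OF that] t(1) by simp
  qed
  have "inj_on \<pi> {..<k}"
    using inj_\<sigma> \<pi>_inv by (metis inj_onI injD lessThan_iff)
  moreover have "\<pi> ` {..<k} \<subseteq> {..<k}" using t(1) by (auto simp: \<pi>_def)
  moreover have "\<pi> (f i) \<noteq> g i" if "i \<in> I" for i
  proof
    assume eq: "\<pi> (f i) = g i"
    have lt: "\<sigma> (f i) < k" using \<sigma>_lt assms(3) that by blast
    have "s i = ((\<sigma> (f i) + t) mod k + (k - \<sigma> (f i))) mod k"
      using eq by (simp add: s_def \<pi>_def)
    also have "\<dots> = (\<sigma> (f i) + t + (k - \<sigma> (f i))) mod k" by (rule mod_add_left_eq)
    also have "\<dots> = t" using lt t(1) by simp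
    finally show False using t(2) that by blast
  qed
  ultimately show ?thesis by blast
qed

text \<open>Colours start at 0, which suits the cyclic shifts modulo \<open>k\<close>; the final
  theorem adds 1.\<close>

definition proper :: "'a rel \<Rightarrow> 'a set \<Rightarrow> nat \<Rightarrow> ('a \<Rightarrow> nat) \<Rightarrow> bool" where
  "proper E W k f \<longleftrightarrow> (\<forall>v\<in>W. f v < k) \<and> (\<forall>u\<in>W. \<forall>v\<in>W. (u, v) \<in> E \<longrightarrow> f u \<noteq> f v)"

lemma free_colour:
  assumes "finite N" "card (f ` N) < k"
  shows "\<exists>c<k. c \<notin> f ` N"
  using card_mono[of "f ` N" "{..<k}"] assms by (metis card_lessThan finite_imageI lessThan_iff not_le subsetI)

context fin_sgraph
begin

lemma finite_nb [simp]: "finite (E `` {v})"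
  using fin_V E_sub by (meson Image_singleton_iff finite_subset mem_Sigma_iff subsetI subset_iff)

lemma E_symD: "(u, v) \<in> E \<Longrightarrow> (v, u) \<in> E"
  using sym_E by (auto dest: symD)

lemma E_neq: "(u, v) \<in> E \<Longrightarrow> u \<noteq> v"
  using irrefl_E by (auto simp: irrefl_def)

lemma E_verts: "(u, v) \<in> E \<Longrightarrow> u \<in> V \<and> v \<in> V"
  using E_sub by auto

section \<open>Greedy colouring and the argument of Brooks\<close>

lemma proper_extend:
  assumes "proper E W k f" "c < k" "c \<notin> f ` (E `` {t} \<inter> W)" "t \<notin> W"
  shows "proper E (insert t W) k (f(t := c))"
  unfolding proper_def
proof (intro conjI ballI impI)
  fix u v assume uv: "u \<in> insert t W" "v \<in> insert t W" "(u, v) \<in> E"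
  then have "u \<noteq> v" "(v, u) \<in> E" by (auto dest: E_neq E_symD)
  then show "(f(t := c)) u \<noteq> (f(t := c)) v"
    using uv assms by (auto simp: proper_def)
qed (use assms in \<open>auto simp: proper_def\<close>)

text \<open>The vertex coloured last always has a neighbour outside the coloured set.\<close>

lemma greedy_extend:
  assumes "finite T" "T \<inter> D = {}" "proper E D k f"
    and "\<And>t. t \<in> T \<Longrightarrow> card (E `` {t}) \<le> k"
    and "\<And>T'. T' \<subseteq> T \<Longrightarrow> T' \<noteq> {} \<Longrightarrow> \<exists>t\<in>T'. \<exists>n. (t, n) \<in> E \<and> n \<notin> D \<union> T'"
  shows "\<exists>f'. proper E (D \<union> T) k f' \<and> (\<forall>d\<in>D. f' d = f d)"
  using assms(1,2,4,5)
proof (induction T rule: finite_psubset_induct)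
  case (psubset T)
  show ?case
  proof (cases "T = {}")
    case True
    then show ?thesis using assms(3) by auto
  next
    case False
    then obtain t n where tn: "t \<in> T" "(t, n) \<in> E" "n \<notin> D \<union> T"
      using psubset.prems(3)[of T] by blast
    have "\<exists>f'. proper E (D \<union> (T - {t})) k f' \<and> (\<forall>d\<in>D. f' d = f d)"
    proof (rule psubset.IH)
      show "\<exists>t'\<in>T'. \<exists>n. (t', n) \<in> E \<and> n \<notin> D \<union> T'" if "T' \<subseteq> T - {t}" "T' \<noteq> {}" for T'
        using that psubset.prems(3)[of T'] by blast
    qed (use tn psubset.prems in auto)
    then obtain f' where f': "proper E (D \<union> (T - {t})) k f'" "\<forall>d\<in>D. f' d = f d" by blast
    let ?N = "E `` {t} \<inter> (D \<union> (T - {t}))"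
    have "card (f' ` ?N) \<le> card ?N" by (intro card_image_le) auto
    \<comment> \<open>The neighbour \<open>n\<close> of \<open>t\<close> is still uncoloured, so
      fewer than \<open>k\<close> colours are blocked at \<open>t\<close>.\<close>
    also have "\<dots> \<le> card (E `` {t} - {n})" using tn(3) by (intro card_mono) auto
    also have "\<dots> < card (E `` {t})" using tn(2) by (intro card_Diff1_less) auto
    also have "\<dots> \<le> k" using psubset.prems(2) tn(1) by blast
    finally obtain c where c: "c < k" "c \<notin> f' ` ?N"
      using free_colour[of ?N f' k] by auto
    have "t \<notin> D \<union> (T - {t})" using tn(1) psubset.prems(1) by auto
    from proper_extend[OF f'(1) c this]
    have "proper E (D \<union> T) k (f'(t := c))" using tn(1) by (simp add: insert_absorb Un_insert_right[symmetric] del: Un_insert_right)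
    moreover have "\<forall>d\<in>D. (f'(t := c)) d = f d" using f'(2) tn(1) psubset.prems(1) by auto
    ultimately show ?thesis by blast
  qed
qed

text \<open>Give \<open>u\<close> and \<open>w\<close> the same colour, colour the others greedily
  towards \<open>v\<close>, and end with \<open>v\<close>, which sees a repeated colour. The degrees
  of \<open>u\<close> and \<open>w\<close> are not bounded, so one of them may be a big
  vertex.\<close>

lemma brooks_colouring:
  assumes "(v, u) \<in> E" "(v, w) \<in> E" "(u, w) \<notin> E" "u \<noteq> w"
    and "conn E (V - {u, w})"
    and "\<And>z. z \<in> V \<Longrightarrow> z \<noteq> u \<Longrightarrow> z \<noteq> w \<Longrightarrow> card (E `` {z}) \<le> k"
  shows "\<exists>f. proper E V k f"
proof -
  have mem: "u \<in> V" "v \<in> V" "w \<in> V" "v \<noteq> u" "v \<noteq> w" using assms(1,2) by (auto dest: E_verts E_neq)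
  have deg_v: "card (E `` {v}) \<le> k" using assms(6) mem by blast
  have "card (E `` {v}) > 0" using assms(1) by (auto simp: card_gt_0_iff)
  with deg_v have "k > 0" by linarith
  let ?D = "{u, w}" and ?T = "V - {u, v, w}"
  have "\<exists>f'. proper E (?D \<union> ?T) k f' \<and> (\<forall>d\<in>?D. f' d = 0)"
  proof (rule greedy_extend)
    show "proper E ?D k (\<lambda>_. 0)"
      using assms(3) \<open>k > 0\<close> by (auto simp: proper_def dest: E_symD E_neq)
    show "\<exists>t\<in>T'. \<exists>n. (t, n) \<in> E \<and> n \<notin> ?D \<union> T'" if "T' \<subseteq> ?T" "T' \<noteq> {}" for T'
    proof -
      \<comment> \<open>\<open>T'\<close> misses \<open>v\<close>, so connectedness gives an edge
        from \<open>T'\<close> to a vertex outside both \<open>T'\<close> and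
        \<open>{u, w}\<close>.\<close>
      have "T' \<subseteq> V - {u, w}" "T' \<noteq> V - {u, w}" using that mem by auto
      with connE[OF assms(5) _ that(2)] show ?thesis by blast
    qed
  qed (use fin_V assms(6) in auto)
  then obtain f where f: "proper E (?D \<union> ?T) k f" "f u = 0" "f w = 0" by auto
  \<comment> \<open>As \<open>u\<close> already shows colour 0 at \<open>v\<close>, leaving out
    \<open>w\<close> loses no colour.\<close>
  have "f w \<in> f ` (E `` {v} - {w})"
    using f(2,3) assms(1,4) by (intro image_eqI[of _ _ u]) auto
  then have "f ` (E `` {v}) = f ` (E `` {v} - {w})" by blast
  then have "card (f ` (E `` {v})) \<le> card (E `` {v} - {w})"
    by (metis card_image_le finite_Diff finite_nb)
  also have "\<dots> < card (E `` {v})" using assms(2) by (intro card_Diff1_less) auto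
  finally obtain c where c: "c < k" "c \<notin> f ` (E `` {v})"
    using free_colour[of "E `` {v}" f k] deg_v by auto
  have "proper E (insert v (?D \<union> ?T)) k (f(v := c))"
    using c mem by (intro proper_extend[OF f(1)]) auto
  moreover have "insert v (?D \<union> ?T) = V" using mem by auto
  ultimately show ?thesis by auto
qed

end

section \<open>Small edge cuts\<close>

context fin_sgraph
begin

lemma finite_E: "finite E"
  using fin_V E_sub by (meson finite_SigmaI finite_subset)

lemma cut_converse: "X \<subseteq> V \<Longrightarrow> E \<inter> (V - X) \<times> - (V - X) = (E \<inter> X \<times> - X)\<inverse>"
  using E_sub by (auto dest: E_symD)

lemma card_cut_complement:
  assumes "X \<subseteq> V"
  shows "card (E \<inter> (V - X) \<times> - (V - X)) = card (E \<inter> X \<times> - X)"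
  by (simp only: cut_converse[OF assms] card_inverse)

text \<open>An arc leaving the intersection or the union leaves \<open>X\<close> or
  \<open>Y\<close>, and an arc leaving both of them leaves both \<open>X\<close> and
  \<open>Y\<close>.\<close>

lemma cut_submodular:
  "card (E \<inter> (X \<inter> Y) \<times> - (X \<inter> Y)) + card (E \<inter> (X \<union> Y) \<times> - (X \<union> Y))
    \<le> card (E \<inter> X \<times> - X) + card (E \<inter> Y \<times> - Y)"
proof -
  let ?d = "\<lambda>Z. E \<inter> Z \<times> - Z"
  have fin: "finite (?d Z)" for Z using finite_E by blast
  have "card (?d (X \<inter> Y)) + card (?d (X \<union> Y))
      = card (?d (X \<inter> Y) \<union> ?d (X \<union> Y)) + card (?d (X \<inter> Y) \<inter> ?d (X \<union> Y))"
    by (rule card_Un_Int[OF fin fin])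
  also have "\<dots> \<le> card (?d X \<union> ?d Y) + card (?d X \<inter> ?d Y)"
    using fin by (intro add_mono card_mono) auto
  also have "\<dots> = card (?d X) + card (?d Y)"
    by (rule card_Un_Int[OF fin fin, symmetric])
  finally show ?thesis .
qed

lemma card_cut_eq_sum:
  assumes "X \<subseteq> V"
  shows "card (E \<inter> X \<times> - X) = (\<Sum>u\<in>X. card (E `` {u} - X))"
proof -
  have "E \<inter> X \<times> - X = (SIGMA u:X. E `` {u} - X)" by auto
  moreover have "finite X" using assms fin_V finite_subset by blast
  ultimately show ?thesis by simp
qed

text \<open>A vertex of \<open>X\<close> has at most \<open>card X - 1\<close> neighbours inside,
  hence at least \<open>k + 1 - card X\<close> outside. Summing over \<open>X\<close> gives at least
  \<open>k\<close>, and a vertex of larger degree makes the sum strictly larger.\<close>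

lemma card_cut_lower:
  assumes "X \<subseteq> V" "X \<noteq> {}" "card X \<le> k" "\<And>v. v \<in> X \<Longrightarrow> k \<le> card (E `` {v})"
  shows "k \<le> card (E \<inter> X \<times> - X)"
    and "x \<in> X \<Longrightarrow> k < card (E `` {x}) \<Longrightarrow> k < card (E \<inter> X \<times> - X)"
proof -
  have finX: "finite X" using assms(1) fin_V finite_subset by blast
  then have X: "0 < card X" using assms(2) by (simp add: card_gt_0_iff)
  have out: "card (E `` {u}) + 1 \<le> card (E `` {u} - X) + card X" if "u \<in> X" for u
  proof -
    have "card (E `` {u}) = card (E `` {u} - X) + card (E `` {u} \<inter> X)"
      by (metis card_Diff_subset_Int card_mono finite_Int finite_nb inf_le1 le_add_diff_inverse2)
    moreover have "card (E `` {u} \<inter> X) < card X"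
      using finX that by (intro psubset_card_mono) (auto dest: E_neq)
    ultimately show ?thesis by linarith
  qed
  have low: "k + 1 - card X \<le> card (E `` {u} - X)" if "u \<in> X" for u
    using out[OF that] assms(4)[OF that] by linarith
  \<comment> \<open>In these terms the product is \<open>(a + 1) * (b + 1)\<close>, which is at
    least \<open>a + 1 + b\<close>.\<close>
  obtain a b where ab: "card X = Suc a" "k = Suc a + b"
    using X assms(3) by (metis Suc_pred' add_Suc le_iff_add)
  have "k \<le> card X * (k + 1 - card X)" by (simp add: ab)
  also have "\<dots> = (\<Sum>u\<in>X. k + 1 - card X)" by simp
  also note low_sum = calculation
  have "(\<Sum>u\<in>X. k + 1 - card X) \<le> (\<Sum>u\<in>X. card (E `` {u} - X))"
    using low by (intro sum_mono) auto
  then show "k \<le> card (E \<inter> X \<times> - X)"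
    using low_sum by (simp only: card_cut_eq_sum[OF assms(1)])
  assume x: "x \<in> X" "k < card (E `` {x})"
  then have "k + 1 - card X < card (E `` {x} - X)"
    using out[OF x(1)] assms(3) by linarith
  then have "(\<Sum>u\<in>X. k + 1 - card X) < (\<Sum>u\<in>X. card (E `` {u} - X))"
    using low x(1) finX by (intro sum_strict_mono_ex1) auto
  then show "k < card (E \<inter> X \<times> - X)"
    using low_sum by (simp only: card_cut_eq_sum[OF assms(1)])
qed

text \<open>The tails of the cut separate the rest of \<open>X\<close> from the complement. Fewer
  than \<open>k\<close> vertices cannot separate, so that rest is empty.\<close>

lemma card_fst_cut:
  assumes "tight k V E" "X \<subseteq> V" "X \<noteq> V" "card (fst ` (E \<inter> X \<times> - X)) < k"
  shows "fst ` (E \<inter> X \<times> - X) = X"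
proof (rule ccontr)
  let ?A = "fst ` (E \<inter> X \<times> - X)"
  assume "?A \<noteq> X"
  moreover have sub: "?A \<subseteq> X" by auto
  ultimately have ne: "X - ?A \<noteq> {}" by blast
  have "conn E (V - ?A)"
    using tightD(2)[OF assms(1) _ assms(4)] sub assms(2) by blast
  moreover have "X - ?A \<subseteq> V - ?A" "X - ?A \<noteq> V - ?A" using assms(2,3) sub by auto
  ultimately obtain a b where "a \<in> X - ?A" "b \<in> V - ?A" "b \<notin> X - ?A" "(a, b) \<in> E"
    using ne by (metis connE)
  then show False by force
qed

text \<open>Either the cut has \<open>k\<close> distinct tails, or \<open>X\<close> consists of
  fewer than \<open>k\<close> tails and the degree count applies.\<close>

lemma tight_cut_ge:
  assumes "tight k V E" "X \<subseteq> V" "X \<noteq> {}" "X \<noteq> V"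
  shows "k \<le> card (E \<inter> X \<times> - X)"
proof (cases "card (fst ` (E \<inter> X \<times> - X)) < k")
  case True
  from card_fst_cut[OF assms(1,2,4) True] True have "card X \<le> k" by simp
  then show ?thesis
    using assms(1-3) by (intro card_cut_lower) (auto simp: tight_def)
next
  case False
  moreover have "card (fst ` (E \<inter> X \<times> - X)) \<le> card (E \<inter> X \<times> - X)"
    using finite_E by (intro card_image_le) auto
  ultimately show ?thesis by simp
qed

text \<open>A big vertex in \<open>X\<close> rules out \<open>card X \<le> k\<close> by the strict
  degree count. Hence there are at least \<open>k\<close> tails on at most \<open>k\<close> arcs, so
  no two arcs share a tail.\<close>

lemma tight_cut_matching:
  assumes "tight k V E" "X \<subseteq> V" "X \<noteq> V" "card (E \<inter> X \<times> - X) \<le> k"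
    and "x \<in> X" "k < card (E `` {x})"
  shows "card (E \<inter> X \<times> - X) = k" "inj_on fst (E \<inter> X \<times> - X)" "k < card X"
proof -
  let ?D = "E \<inter> X \<times> - X"
  have finD: "finite ?D" and finX: "finite X"
    using finite_E assms(2) fin_V finite_subset by blast+
  have big: "k < card X"
  proof (rule ccontr)
    assume "\<not> k < card X"
    then have "k < card ?D"
      using assms(1,2,5,6) by (intro card_cut_lower(2)[of X k x]) (auto simp: tight_def)
    then show False using assms(4) by simp
  qed
  then show "k < card X" .
  have "k \<le> card (fst ` ?D)"
  proof (rule ccontr)
    assume "\<not> k \<le> card (fst ` ?D)"
    then have "card (fst ` ?D) < k" by simp
    with card_fst_cut[OF assms(1-3) this] big show False by simp
  qed
  moreover have "card (fst ` ?D) \<le> card ?D" using finD by (rule card_image_le)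
  ultimately have "card ?D = k" "card (fst ` ?D) = card ?D" using assms(4) by auto
  then show "card ?D = k" "inj_on fst ?D" using finD eq_card_imp_inj_on by auto
qed

end

section \<open>Replacing one side of a cut by a clique\<close>

definition cut_heads :: "'a rel \<Rightarrow> 'a set \<Rightarrow> 'a set" where
  "cut_heads E X = snd ` (E \<inter> X \<times> - X)"

text \<open>
  The complement of \<open>X\<close> is replaced by a clique on those of its vertices that have a neighbour in
  \<open>X\<close>, which avoids the need for fresh vertices.
\<close>

definition clique_side :: "'a rel \<Rightarrow> 'a set \<Rightarrow> 'a rel" where
  "clique_side E X = {(u, v) \<in> E. u \<in> X \<or> v \<in> X} \<inter> (X \<union> cut_heads E X) \<times> (X \<union> cut_heads E X)
     \<union> {(u, v). u \<in> cut_heads E X \<and> v \<in> cut_heads E X \<and> u \<noteq> v}"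

lemma cut_heads_disjoint: "b \<in> cut_heads E X \<Longrightarrow> b \<notin> X"
  by (auto simp: cut_heads_def)

lemma cut_headsI: "(a, b) \<in> E \<Longrightarrow> a \<in> X \<Longrightarrow> b \<notin> X \<Longrightarrow> b \<in> cut_heads E X"
  unfolding cut_heads_def by (metis (no_types, lifting) ComplI IntI SigmaI image_eqI snd_conv)

lemma clique_side_edge:
  assumes "v \<in> X"
  shows "(v, u) \<in> clique_side E X \<longleftrightarrow> (v, u) \<in> E"
  using assms cut_heads_disjoint[of v E X] cut_headsI[of v u E X]
  by (auto simp: clique_side_def)

lemma clique_side_nb: "v \<in> X \<Longrightarrow> clique_side E X `` {v} = E `` {v}"
  by (simp add: set_eq_iff clique_side_edge)

lemma clique_side_heads:
  "b \<in> cut_heads E X \<Longrightarrow> b' \<in> cut_heads E X \<Longrightarrow> b \<noteq> b' \<Longrightarrow> (b, b') \<in> clique_side E X"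
  by (simp add: clique_side_def)

lemma two_elements:
  assumes "2 \<le> card B"
  obtains b b' where "b \<in> B" "b' \<in> B" "b \<noteq> b'"
proof -
  have "finite B" using assms by (intro card_ge_0_finite) linarith
  moreover have "\<not> card B \<le> Suc 0" using assms by linarith
  ultimately show thesis using that card_le_Suc0_iff_eq by blast
qed

lemma inj_on_converse:
  "inj_on fst (R\<inverse>) \<longleftrightarrow> inj_on snd R" "inj_on snd (R\<inverse>) \<longleftrightarrow> inj_on fst R"
  by (simp add: inj_on_def Ball_def split_paired_All, blast)+

context fin_sgraph
begin

lemma cut_heads_subset: "cut_heads E X \<subseteq> V"
  unfolding cut_heads_def using E_sub by auto

lemma fin_sgraph_clique_side:
  assumes "X \<subseteq> V"
  shows "fin_sgraph (X \<union> cut_heads E X) (clique_side E X)"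
proof
  show "finite (X \<union> cut_heads E X)"
    using assms cut_heads_subset fin_V finite_subset by (metis Un_least)
  show "sym (clique_side E X)"
    by (rule symI) (auto simp: clique_side_def dest: E_symD)
  show "irrefl (clique_side E X)"
    by (auto simp: clique_side_def irrefl_def dest: E_neq)
qed (auto simp: clique_side_def)

lemma clique_side_nb_head:
  assumes "inj_on snd (E \<inter> X \<times> - X)" "b \<in> cut_heads E X"
  shows "\<exists>a\<in>X. clique_side E X `` {b} = insert a (cut_heads E X - {b})"
proof -
  obtain a where a: "(a, b) \<in> E" "a \<in> X" "b \<notin> X"
    using assms(2) by (auto simp: cut_heads_def)
  have uniq: "a' = a" if "(b, a') \<in> E" "a' \<in> X" for a'
  proof -
    have "(a', b) = (a, b)"
      using that a by (intro inj_onD[OF assms(1)]) (auto dest: E_symD)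
    then show ?thesis by simp
  qed
  show ?thesis
  proof (intro bexI[of _ a] set_eqI)
    fix z
    show "z \<in> clique_side E X `` {b} \<longleftrightarrow> z \<in> insert a (cut_heads E X - {b})"
      using a assms(2) uniq cut_heads_disjoint[of _ E X] E_symD
      by (auto simp: clique_side_def)
  qed (rule a(2))
qed

text \<open>One neighbour in \<open>X\<close> and \<open>k - 1\<close> in the clique: the heads are
  never big in the new graph.\<close>

lemma card_clique_side_nb_head:
  assumes "card (E \<inter> X \<times> - X) = k" "inj_on snd (E \<inter> X \<times> - X)" "b \<in> cut_heads E X"
  shows "card (clique_side E X `` {b}) = k"
proof -
  obtain a where a: "a \<in> X" "clique_side E X `` {b} = insert a (cut_heads E X - {b})"
    using clique_side_nb_head[OF assms(2,3)] by blast
  have "finite (cut_heads E X)" using cut_heads_subset fin_V finite_subset by blast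
  moreover have "a \<notin> cut_heads E X" using a(1) cut_heads_disjoint[of a E X] by auto
  moreover have "card (cut_heads E X) = k"
    using assms(1,2) by (simp add: cut_heads_def card_image)
  moreover have "card (cut_heads E X) = Suc (card (cut_heads E X - {b}))"
    using calculation(1) assms(3) by (rule card.remove)
  ultimately show ?thesis using a(2) by simp
qed

text \<open>Some head survives the deletion of \<open>S\<close>. A set without heads has an outgoing
  edge inherited from \<open>E\<close>; if a set contains a head, either the clique provides an
  outgoing edge or the complement has no heads, and then the first case applies to the
  complement.\<close>

lemma conn_clique_side:
  assumes "tight k V E" "X \<subseteq> V" "card (E \<inter> X \<times> - X) = k" "inj_on snd (E \<inter> X \<times> - X)"
    and "S \<subseteq> X \<union> cut_heads E X" "card S < k"
  shows "conn (clique_side E X) (X \<union> cut_heads E X - S)"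
proof -
  interpret H: fin_sgraph "X \<union> cut_heads E X" "clique_side E X"
    by (rule fin_sgraph_clique_side[OF assms(2)])
  let ?B = "cut_heads E X" and ?W = "X \<union> cut_heads E X - S"
  have finS: "finite S" using assms(5) H.fin_V finite_subset by blast
  have "card ?B = k" using assms(3,4) by (simp add: cut_heads_def card_image)
  then have "\<not> ?B \<subseteq> S" using card_mono[OF finS, of ?B] assms(6) by auto
  then obtain b0 where b0: "b0 \<in> ?B" "b0 \<notin> S" by blast
  have "conn E (V - S)"
    using tightD(2)[OF assms(1) _ assms(6)] assms(2,5) cut_heads_subset[of X] by blast
  note conn = connE[OF this]
  have inside: "\<exists>a\<in>A. \<exists>b\<in>?W - A. (a, b) \<in> clique_side E X"
    if A: "A \<subseteq> ?W" "A \<noteq> {}" "A \<inter> ?B = {}" for A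
  proof -
    have AX: "A \<subseteq> X" using A by auto
    have "A \<subseteq> V - S" "A \<noteq> V - S"
      using A(1,3) assms(2) b0 cut_heads_subset[of X] by blast+
    then obtain a b where ab: "a \<in> A" "b \<in> V - S" "b \<notin> A" "(a, b) \<in> E"
      using A(2) conn by metis
    then have "b \<in> ?W" using AX cut_headsI[of a b E X] by blast
    then show ?thesis using ab AX clique_side_edge[of a X b E] by blast
  qed
  show ?thesis
    unfolding conn_def
  proof (intro allI impI)
    fix A assume A: "A \<subseteq> ?W" "A \<noteq> {}" "A \<noteq> ?W"
    show "\<exists>a\<in>A. \<exists>b\<in>?W - A. (a, b) \<in> clique_side E X"
    proof (rule ccontr)
      assume none: "\<not> ?thesis"
      then obtain c where c: "c \<in> A" "c \<in> ?B" using inside A by blast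
      then have "(?W - A) \<inter> ?B = {}"
        using none clique_side_heads[of c E X] by blast
      with inside[of "?W - A"] A
      obtain a b where "a \<in> ?W - A" "b \<in> ?W - (?W - A)" "(a, b) \<in> clique_side E X" by blast
      then show False using none H.E_symD by blast
    qed
  qed
qed

text \<open>Big vertices of the new graph lie in \<open>X\<close> and were big before. A small cut
  separating them can be moved inside \<open>X\<close>, where both graphs have the same cuts: since
  \<open>X\<close> has exactly \<open>k\<close> cut edges and the union at least \<open>k\<close>,
  submodularity bounds the intersection.\<close>

lemma tight_clique_side:
  assumes "tight k V E" "X \<subseteq> V" "card (E \<inter> X \<times> - X) = k" "inj_on snd (E \<inter> X \<times> - X)"
  shows "tight k (X \<union> cut_heads E X) (clique_side E X)"
  unfolding tight_def
proof (intro conjI ballI allI impI)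
  note deg_head = card_clique_side_nb_head[OF assms(3,4)]
  {
    fix v assume "v \<in> X \<union> cut_heads E X"
    then show "k \<le> card (clique_side E X `` {v})"
      using assms(1,2) deg_head[of v] by (auto simp: tight_def clique_side_nb)
  next
    fix S assume "S \<subseteq> X \<union> cut_heads E X" "card S < k"
    then show "conn (clique_side E X) (X \<union> cut_heads E X - S)"
      by (rule conn_clique_side[OF assms])
  next
    fix x y assume xy: "x \<in> X \<union> cut_heads E X" "y \<in> X \<union> cut_heads E X" "x \<noteq> y"
      "k < card (clique_side E X `` {x})" "k < card (clique_side E X `` {y})"
    then have mem: "x \<in> X" "y \<in> X" using deg_head by fastforce+
    then obtain U where U: "U \<subseteq> V" "(x \<in> U) \<noteq> (y \<in> U)" "card (E \<inter> U \<times> - U) \<le> k"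
      using tightD(3)[OF assms(1), of x y] assms(2) xy(3-5) by (auto simp: clique_side_nb)
    have inside: "clique_side E X \<inter> Z \<times> - Z = E \<inter> Z \<times> - Z" if "Z \<subseteq> X" for Z
      using that clique_side_edge[of _ X _ E] by blast
    \<comment> \<open>Uncrossing \<open>U\<close> and \<open>X\<close>.\<close>
    have "\<exists>Z\<subseteq>X. (x \<in> Z) \<noteq> (y \<in> Z) \<and> card (E \<inter> Z \<times> - Z) \<le> k"
    proof (cases "U \<union> X = V")
      case True
      then have "V - U \<subseteq> X" by blast
      moreover have "(x \<in> V - U) \<noteq> (y \<in> V - U)" using U(2) mem assms(2) by blast
      moreover have "card (E \<inter> (V - U) \<times> - (V - U)) \<le> k"
        using card_cut_complement[OF U(1)] U(3) by simp
      ultimately show ?thesis by blast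
    next
      case False
      then have "k \<le> card (E \<inter> (U \<union> X) \<times> - (U \<union> X))"
        using U(1) assms(2) mem(1) by (intro tight_cut_ge[OF assms(1)]) auto
      then have "card (E \<inter> (U \<inter> X) \<times> - (U \<inter> X)) \<le> k"
        using cut_submodular[of U X] U(3) assms(3) by linarith
      moreover have "(x \<in> U \<inter> X) \<noteq> (y \<in> U \<inter> X)" using U(2) mem by blast
      ultimately show ?thesis by (intro exI[of _ "U \<inter> X"]) auto
    qed
    then show "\<exists>U\<subseteq>X \<union> cut_heads E X. (x \<in> U) \<noteq> (y \<in> U) \<and>
        card (clique_side E X \<inter> U \<times> - U) \<le> k"
      using inside by (metis le_supI1)
  }
qed

text \<open>A universal vertex in \<open>X\<close> would be the tail of two cut edges, and a
  universal head would be the head of two. This excludes the second alternative of the induction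
  hypothesis.\<close>

lemma clique_side_no_universal:
  assumes "2 \<le> k" "card (E \<inter> X \<times> - X) = k" "inj_on fst (E \<inter> X \<times> - X)"
    "inj_on snd (E \<inter> X \<times> - X)" "k < card X" "h \<in> X \<union> cut_heads E X"
  shows "\<exists>v\<in>X \<union> cut_heads E X - {h}. (h, v) \<notin> clique_side E X"
proof (rule ccontr)
  assume "\<not> ?thesis"
  then have univ: "(h, v) \<in> clique_side E X" if "v \<in> X \<union> cut_heads E X" "v \<noteq> h" for v
    using that by blast
  have card_B: "card (cut_heads E X) = k" using assms(2,4) by (simp add: cut_heads_def card_image)
  show False
  proof (cases "h \<in> X")
    case True
    obtain b b' where b: "b \<in> cut_heads E X" "b' \<in> cut_heads E X" "b \<noteq> b'"
      using card_B assms(1) two_elements by metis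
    have "(h, b) = (h, b')"
      using b True univ[of b] univ[of b'] clique_side_edge[OF True] cut_heads_disjoint[of _ E X]
      by (intro inj_onD[OF assms(3)]) auto
    then show False using b(3) by simp
  next
    case False
    obtain a a' where a: "a \<in> X" "a' \<in> X" "a \<noteq> a'"
      using assms(1,5) two_elements[of X] by (metis le_trans less_imp_le)
    have "(h, a) \<in> E" "(h, a') \<in> E"
      using a False univ[of a] univ[of a'] cut_heads_disjoint[of a E X] cut_heads_disjoint[of a' E X]
      by (auto simp: clique_side_def)
    then have "(a, h) = (a', h)"
      using a False by (intro inj_onD[OF assms(4)]) (auto dest: E_symD)
    then show False using a(3) by simp
  qed
qed

section \<open>Colouring the two sides and gluing along the cut\<close>

lemma clique_side_colouring:
  assumes "0 < k" "card (E \<inter> X \<times> - X) = k" "inj_on snd (E \<inter> X \<times> - X)"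
    and "proper (clique_side E X) (X \<union> cut_heads E X) k f"
  shows "proper E X k f"
    and "\<exists>d\<in>E \<inter> X \<times> - X. \<exists>d'\<in>E \<inter> X \<times> - X. f (fst d) \<noteq> f (fst d')"
proof -
  show "proper E X k f"
    using assms(4) clique_side_edge[of _ X _ E] by (simp add: proper_def)
  let ?D = "E \<inter> X \<times> - X"
  show "\<exists>d\<in>?D. \<exists>d'\<in>?D. f (fst d) \<noteq> f (fst d')"
  proof (rule ccontr)
    assume const: "\<not> ?thesis"
    \<comment> \<open>The clique uses all \<open>k\<close> colours, so a constant colour on the tails clashes with a head.\<close>
    have "inj_on f (cut_heads E X)"
      using assms(4) clique_side_heads[of _ E X] unfolding proper_def inj_on_def by blast
    moreover have "card (cut_heads E X) = k"
      using assms(2,3) by (simp add: cut_heads_def card_image)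
    moreover have "f ` cut_heads E X \<subseteq> {..<k}" using assms(4) by (auto simp: proper_def)
    ultimately have all: "f ` cut_heads E X = {..<k}"
      by (intro card_subset_eq) (simp_all add: card_image)
    have "?D \<noteq> {}" using assms(1,2) by auto
    then obtain d where d: "d \<in> ?D" by blast
    then have "f (fst d) < k" using assms(4) by (auto simp: proper_def)
    then obtain b where b: "b \<in> cut_heads E X" "f b = f (fst d)" using all by (metis imageE lessThan_iff)
    obtain a where a: "(a, b) \<in> ?D" using b(1) by (auto simp: cut_heads_def)
    then have "(a, b) \<in> clique_side E X" using clique_side_edge[of a X b E] by blast
    then have "f a \<noteq> f b" using assms(4) a b(1) by (auto simp: proper_def)
    then show False using const d a b(2) by force
  qed
qed

lemma merge_colourings:
  assumes "X \<subseteq> V" "card (E \<inter> X \<times> - X) \<le> k" "proper E X k f" "proper E (V - X) k g"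
    and "d1 \<in> E \<inter> X \<times> - X" "d2 \<in> E \<inter> X \<times> - X" "f (fst d1) \<noteq> f (fst d2)"
    and "d3 \<in> E \<inter> X \<times> - X" "d4 \<in> E \<inter> X \<times> - X" "g (snd d3) \<noteq> g (snd d4)"
  shows "\<exists>h. proper E V k h"
proof -
  let ?D = "E \<inter> X \<times> - X"
  have heads: "snd d \<in> V - X" "fst d \<in> X" if "d \<in> ?D" for d
    using that E_sub by auto
  \<comment> \<open>Two functions that are both non-constant on a set differ simultaneously on some
    pair of its elements.\<close>
  obtain e1 e2 where e: "e1 \<in> ?D" "e2 \<in> ?D" "f (fst e1) \<noteq> f (fst e2)" "g (snd e1) \<noteq> g (snd e2)"
    using assms(5-10) by metis
  \<comment> \<open>The index set consists of the cut edges, with the colours of their two ends;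
    \<open>\<pi>\<close> recolours the side \<open>X\<close>.\<close>
  have "\<exists>\<pi>. inj_on \<pi> {..<k} \<and> \<pi> ` {..<k} \<subseteq> {..<k} \<and> (\<forall>d\<in>?D. \<pi> ((f \<circ> fst) d) \<noteq> (g \<circ> snd) d)"
    using finite_E assms(2-4) e heads by (intro permutation_avoiding[of _ _ _ _ e1 e2]) (auto simp: proper_def)
  then obtain \<pi> where \<pi>: "inj_on \<pi> {..<k}" "\<pi> ` {..<k} \<subseteq> {..<k}"
    "\<forall>d\<in>?D. \<pi> (f (fst d)) \<noteq> g (snd d)" by auto
  have cross: "\<pi> (f a) \<noteq> g b" if "(a, b) \<in> ?D" for a b
    using bspec[OF \<pi>(3) that] by simp
  have f: "f u < k" "u \<in> X \<Longrightarrow> v \<in> X \<Longrightarrow> (u, v) \<in> E \<Longrightarrow> f u \<noteq> f v" if "u \<in> X" for u v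
    using that assms(3) by (auto simp: proper_def)
  have "proper E V k (\<lambda>v. if v \<in> X then \<pi> (f v) else g v)"
    unfolding proper_def
  proof (intro conjI ballI impI)
    fix v assume "v \<in> V"
    then show "(if v \<in> X then \<pi> (f v) else g v) < k"
      using \<pi>(2) f(1)[of v] assms(4) by (auto simp: proper_def)
  next
    fix u v assume uv: "u \<in> V" "v \<in> V" "(u, v) \<in> E"
    show "(if u \<in> X then \<pi> (f u) else g u) \<noteq> (if v \<in> X then \<pi> (f v) else g v)"
      using cross[of u v] cross[of v u] inj_on_eq_iff[OF \<pi>(1), of "f u" "f v"] f[of u] f[of v]
        uv E_symD[OF uv(3)] assms(4)
      by (auto simp: proper_def)
  qed
  then show ?thesis by blast
qed

text \<open>If \<open>h\<close> is not universal, connectedness gives a vertex \<open>w\<close> at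
  distance two from \<open>h\<close>. Deleting \<open>h\<close> and \<open>w\<close> keeps the graph
  connected since \<open>k \<ge> 3\<close>, so the Brooks argument applies with \<open>h\<close> as
  the vertex of unbounded degree.\<close>

lemma colouring_or_universal_if_few_big:
  assumes "3 \<le> k" "tight k V E" "h \<in> V" "\<And>v. v \<in> V \<Longrightarrow> v \<noteq> h \<Longrightarrow> card (E `` {v}) \<le> k"
  shows "(\<exists>f. proper E V k f) \<or> (\<forall>v\<in>V - {h}. (h, v) \<in> E)"
proof (rule disjCI)
  assume "\<not> (\<forall>v\<in>V - {h}. (h, v) \<in> E)"
  then have ne: "insert h (E `` {h}) \<noteq> V" by blast
  have cn: "conn E (V - S)" if "S \<subseteq> V" "card S < k" for S
    using that assms(2) by (simp add: tight_def)
  have "conn E V" using cn[of "{}"] assms(1) by simp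
  moreover have "insert h (E `` {h}) \<subseteq> V" using assms(3) E_sub by auto
  ultimately obtain v w where vw: "v \<in> insert h (E `` {h})" "w \<in> V" "w \<notin> insert h (E `` {h})" "(v, w) \<in> E"
    using ne connE by (metis insert_not_empty)
  have "card {h, w} < k" using assms(1) by (simp add: card_insert_if)
  then show "\<exists>f. proper E V k f"
    using vw assms(3,4) cn[of "{h, w}"] by (intro brooks_colouring[of v h w]) (auto dest: E_symD)
qed

end

text \<open>The second alternative makes room for tight graphs that need more colours, such as the
  complete graph on \<open>k + 1\<close> vertices. The induction hypothesis is applied only to
  graphs without universal vertex, where it yields a colouring.\<close>

lemma tight_colouring_or_universal:
  assumes "fin_sgraph V E" "3 \<le> k" "tight k V E"
  shows "(\<exists>f. proper E V k f) \<or>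
    (\<exists>h\<in>V. \<forall>v\<in>V - {h}. (h, v) \<in> E \<and> card (E `` {v}) \<le> k)"
  using assms(1,3)
proof (induction "card V" arbitrary: V E rule: less_induct)
  case less
  interpret fin_sgraph V E by fact
  show ?case
  proof (cases "\<exists>x\<in>V. \<exists>y\<in>V. x \<noteq> y \<and> k < card (E `` {x}) \<and> k < card (E `` {y})")
    case True
    then obtain x y where xy: "x \<in> V" "y \<in> V" "x \<noteq> y" "k < card (E `` {x})" "k < card (E `` {y})"
      by blast
    then obtain U where U: "U \<subseteq> V" "(x \<in> U) \<noteq> (y \<in> U)" "card (E \<inter> U \<times> - U) \<le> k"
      using tightD(3)[OF less.prems(2), of x y] by blast
    then obtain x' y' where x'y': "x' \<in> U" "y' \<in> V - U" "k < card (E `` {x'})" "k < card (E `` {y'})"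
      using xy by blast
    define D where "D = E \<inter> U \<times> - U"
    have D': "E \<inter> (V - U) \<times> - (V - U) = D\<inverse>" using cut_converse[OF U(1)] by (simp add: D_def)
    note mX = tight_cut_matching[OF less.prems(2) U(1) _ U(3) x'y'(1,3), folded D_def]
    have ne: "V - U \<noteq> V" using x'y'(1) U(1) by blast
    have le: "card (E \<inter> (V - U) \<times> - (V - U)) \<le> k"
      using card_cut_complement[OF U(1)] U(3) by simp
    note mY = tight_cut_matching(2,3)[OF less.prems(2) Diff_subset ne le x'y'(2,4), unfolded D']
    have cardD: "card D = k" and injf: "inj_on fst D" and bigX: "k < card U"
      using mX x'y'(2) by auto
    \<comment> \<open>Seen from \<open>V - U\<close> the cut is reversed, so distinct tails there
      are distinct heads of \<open>D\<close>, and \<open>D\<close> is a matching.\<close>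
    have injs: "inj_on snd D" using mY(1) by (simp add: inj_on_converse)
    have injs': "inj_on snd (D\<inverse>)" using injf by (simp add: inj_on_converse)
    have part: "\<exists>f. proper E X k f \<and> (\<exists>d\<in>E \<inter> X \<times> - X. \<exists>d'\<in>E \<inter> X \<times> - X. f (fst d) \<noteq> f (fst d'))"
      if X: "X \<subseteq> V" "card (E \<inter> X \<times> - X) = k" "inj_on fst (E \<inter> X \<times> - X)"
        "inj_on snd (E \<inter> X \<times> - X)" "k < card X" "k < card (V - X)" for X
    proof -
      let ?V = "X \<union> cut_heads E X"
      have card_heads: "card (cut_heads E X) = k" using X(2,4) by (simp add: cut_heads_def card_image)
      \<comment> \<open>The graph shrinks because more than \<open>k\<close> vertices are replaced
        by \<open>k\<close>.\<close>
      have "card ?V \<le> card X + k" using card_Un_le[of X "cut_heads E X"] card_heads by simp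
      also have "\<dots> < card X + card (V - X)" using X(6) by simp
      also have "\<dots> = card V" using X(1) fin_V by (metis add.commute card_Diff_subset card_mono finite_subset le_add_diff_inverse2)
      finally have "card ?V < card V" .
      note IH = less.hyps[OF this fin_sgraph_clique_side[OF X(1)] tight_clique_side[OF less.prems(2) X(1,2,4)]]
      have "2 \<le> k" using assms(2) by simp
      note clique_side_no_universal[OF this X(2-5)]
      with IH obtain f where "proper (clique_side E X) ?V k f" by blast
      from clique_side_colouring[OF _ X(2,4) this] assms(2) show ?thesis by auto
    qed
    obtain f d1 d2 where f: "proper E U k f" "d1 \<in> D" "d2 \<in> D" "f (fst d1) \<noteq> f (fst d2)"
      using part[of U] U(1) cardD injf injs bigX mY(2) by (auto simp: D_def)
    have "V - (V - U) = U" using U(1) by blast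
    then obtain g d3 d4 where g: "proper E (V - U) k g" "d3 \<in> D\<inverse>" "d4 \<in> D\<inverse>" "g (fst d3) \<noteq> g (fst d4)"
      using part[of "V - U"] cardD mY injs' bigX unfolding D' by (metis Diff_subset card_inverse)
    \<comment> \<open>Reversing the arcs turns the tails on which \<open>g\<close> varies into heads
      of \<open>D\<close>.\<close>
    have "prod.swap d3 \<in> D" "prod.swap d4 \<in> D" "g (snd (prod.swap d3)) \<noteq> g (snd (prod.swap d4))"
      using g(2-4) by (auto simp: prod.swap_def)
    from merge_colourings[OF U(1,3) f(1) g(1), folded D_def, OF f(2-4) this]
    show ?thesis by (rule disjI1)
  next
    case False
    show ?thesis
    proof (cases "V = {}")
      case True
      then have "proper E V k (\<lambda>_. 0)" by (simp add: proper_def)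
      then show ?thesis by blast
    next
      case nonempty: False
      \<comment> \<open>The only big vertex, or an arbitrary vertex if there is none.\<close>
      obtain h where h: "h \<in> V" "\<And>v. v \<in> V \<Longrightarrow> v \<noteq> h \<Longrightarrow> card (E `` {v}) \<le> k"
      proof (cases "\<exists>x\<in>V. k < card (E `` {x})")
        case True
        then obtain x where "x \<in> V" "k < card (E `` {x})" by blast
        then show thesis using that[of x] False by (meson not_le)
      next
        case noneBig: False
        then show thesis using that nonempty by (meson all_not_in_conv not_le)
      qed
      then show ?thesis
        using colouring_or_universal_if_few_big[OF assms(2) less.prems(2) h] by blast
    qed
  qed
qed

section \<open>Graphs with a universal vertex\<close>

lemma conn_cong:
  assumes "conn E W" "\<And>a b. a \<in> W \<Longrightarrow> b \<in> W \<Longrightarrow> (a, b) \<in> E \<Longrightarrow> (a, b) \<in> F"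
  shows "conn F W"
  unfolding conn_def
proof (intro allI impI)
  fix A assume A: "A \<subseteq> W" "A \<noteq> {}" "A \<noteq> W"
  obtain a b where "a \<in> A" "b \<in> W" "b \<notin> A" "(a, b) \<in> E"
    using connE[OF assms(1) A] .
  then show "\<exists>a\<in>A. \<exists>b\<in>W - A. (a, b) \<in> F" using assms(2) A(1) by blast
qed

lemma set_zip_rotate1:
  "(u, v) \<in> set (zip c (rotate1 c)) \<longleftrightarrow> (\<exists>i<length c. u = c ! i \<and> v = c ! (Suc i mod length c))"
  by (auto simp: in_set_zip nth_rotate1)

lemma in_symcl: "(u, v) \<in> symcl R \<longleftrightarrow> (u, v) \<in> R \<or> (v, u) \<in> R"
  by (auto simp: symcl_def)

context fin_sgraph
begin

text \<open>All neighbours of the last vertex of a longest path lie on the path, and the one that is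
  not its predecessor must be the first vertex.\<close>

lemma two_regular_longest_path:
  assumes "V \<noteq> {}" "\<And>v. v \<in> V \<Longrightarrow> card (E `` {v}) = 2"
  obtains c where "distinct c" "set c \<subseteq> V" "3 \<le> length c"
    and "\<And>i. Suc i < length c \<Longrightarrow> (c ! i, c ! Suc i) \<in> E"
    and "(c ! (length c - 1), c ! 0) \<in> E"
proof -
  define path where
    "path c \<longleftrightarrow> distinct c \<and> set c \<subseteq> V \<and> (\<forall>i. Suc i < length c \<longrightarrow> (c ! i, c ! Suc i) \<in> E)" for c
  obtain v0 where "v0 \<in> V" using assms(1) by blast
  then have start: "path [v0]" by (auto simp: path_def)
  have bound: "length c < Suc (card V)" if "path c" for c
    using that fin_V by (metis path_def card_mono distinct_card less_Suc_eq_le)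
  define c where "c = (ARG_MAX length c. path c)"
  have c: "path c" "\<And>d. path d \<Longrightarrow> length d \<le> length c"
    using arg_max_nat_lemma[of path "[v0]" length "Suc (card V)"] start bound
    by (auto simp: c_def)
  define n where "n = length c"
  have "n \<ge> 1" using c(2)[OF start] by (simp add: n_def)
  have dist: "distinct c" and sub: "set c \<subseteq> V" and step: "\<And>i. Suc i < n \<Longrightarrow> (c ! i, c ! Suc i) \<in> E"
    using c(1) by (auto simp: path_def n_def)
  define l where "l = c ! (n - 1)"
  have l: "l \<in> set c" "l \<in> V" using \<open>n \<ge> 1\<close> sub by (auto simp: l_def n_def)
  have nb_l: "z \<in> set c" if "(l, z) \<in> E" for z
  proof (rule ccontr)
    assume z: "z \<notin> set c"
    have "path (c @ [z])"
      unfolding path_def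
    proof (intro conjI allI impI)
      fix i assume i: "Suc i < length (c @ [z])"
      show "((c @ [z]) ! i, (c @ [z]) ! Suc i) \<in> E"
      proof (cases "Suc i < n")
        case True
        then show ?thesis using step[OF True] by (simp add: nth_append n_def)
      next
        case False
        then have "i = length c - 1" "i < length c" "Suc i = length c"
          using i by (simp_all add: n_def)
        moreover from this have "c ! i = l" by (simp add: l_def n_def)
        ultimately show ?thesis using that by (simp add: nth_append del: One_nat_def)
      qed
    qed (use z dist sub that E_verts in auto)
    from c(2)[OF this] show False by simp
  qed
  have "E `` {l} \<subseteq> set c - {l}" using nb_l by (auto dest: E_neq)
  then have "2 \<le> card (set c - {l})"
    using assms(2)[OF l(2)] card_mono[of "set c - {l}" "E `` {l}"] by simp
  then have n3: "3 \<le> n"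
    using l(1) dist by (simp add: n_def distinct_card)
  have prev: "(l, c ! (n - 2)) \<in> E"
    using step[of "n - 2"] n3 E_symD by (simp add: l_def numeral_2_eq_2 Suc_diff_Suc)
  have "\<exists>z. (l, z) \<in> E \<and> z \<noteq> c ! (n - 2)"
  proof (rule ccontr)
    assume "\<not> ?thesis"
    then have "E `` {l} \<subseteq> {c ! (n - 2)}" by auto
    then have "card (E `` {l}) \<le> 1" using card_mono[of "{c ! (n - 2)}"] by simp
    then show False using assms(2)[OF l(2)] by simp
  qed
  then obtain z where z: "(l, z) \<in> E" "z \<noteq> c ! (n - 2)" by blast
  obtain j where j: "j < n" "z = c ! j" using nb_l[OF z(1)] by (auto simp: in_set_conv_nth n_def)
  \<comment> \<open>Otherwise the inner vertex \<open>z\<close> of the path would have three neighbours.\<close>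
  have "j = 0"
  proof (rule ccontr)
    assume "j \<noteq> 0"
    have "j \<noteq> n - 1" using z(1) j(2) by (auto simp: l_def dest: E_neq)
    moreover have "j \<noteq> n - 2" using z(2) j(2) by auto
    ultimately have j2: "Suc j < n - 1" using j(1) by linarith
    have "{c ! (j - 1), c ! Suc j, l} \<subseteq> E `` {z}"
      using step[of "j - 1"] step[of j] \<open>j \<noteq> 0\<close> j j2 z(1) E_symD by auto
    moreover have "card {c ! (j - 1), c ! Suc j, l} = 3"
      using dist j2 \<open>j \<noteq> 0\<close> by (auto simp: l_def n_def nth_eq_iff_index_eq card_insert_if)
    ultimately have "3 \<le> card (E `` {z})" by (metis card_mono finite_nb)
    then show False using assms(2) z(1) E_verts by fastforce
  qed
  then have "(c ! (length c - 1), c ! 0) \<in> E" using z(1) j(2) by (simp add: l_def n_def)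
  then show thesis using that[of c] dist sub n3 step by (simp add: n_def)
qed

text \<open>The cycle already uses both neighbours of each of its vertices. Hence it has no chords
  and no edge leaves it, so by connectedness it is the whole graph.\<close>

lemma two_regular_cycle:
  assumes "V \<noteq> {}" "\<And>v. v \<in> V \<Longrightarrow> card (E `` {v}) = 2" "conn E V"
  obtains c where "distinct c" "3 \<le> length c" "set c = V" "E = symcl (set (zip c (rotate1 c)))"
proof -
  obtain c where c: "distinct c" "set c \<subseteq> V" "3 \<le> length c"
    "\<And>i. Suc i < length c \<Longrightarrow> (c ! i, c ! Suc i) \<in> E" "(c ! (length c - 1), c ! 0) \<in> E"
    using two_regular_longest_path[OF assms(1,2)] by metis
  define n where "n = length c"
  have n3: "3 \<le> n" using c(3) by (simp add: n_def)
  have succ: "(c ! i, c ! (Suc i mod n)) \<in> E" if "i < n" for i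
  proof (cases "Suc i < n")
    case True
    then show ?thesis using c(4) by (simp add: n_def)
  next
    case False
    then have "n = Suc i" using that by simp
    then have "i = n - 1" "Suc i mod n = 0" by simp_all
    then show ?thesis using c(5) by (simp add: n_def)
  qed
  have nb: "\<exists>p<n. Suc p mod n = i \<and> E `` {c ! i} = {c ! (Suc i mod n), c ! p}" if i: "i < n" for i
  proof -
    \<comment> \<open>The cyclic predecessor of \<open>i\<close>; it differs from the successor
      because \<open>n \<ge> 3\<close>.\<close>
    obtain p where p: "p < n" "Suc p mod n = i" "p \<noteq> Suc i mod n"
    proof (cases i)
      case 0
      then show ?thesis using that[of "n - 1"] n3 by simp
    next
      case (Suc m)
      have "m \<noteq> Suc i mod n"
      proof (cases "Suc i < n")
        case True
        then show ?thesis using Suc by simp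
      next
        case False
        then have n: "n = Suc i" using i by simp
        then have "Suc i mod n = 0" by simp
        moreover have "m \<noteq> 0" using n n3 Suc by linarith
        ultimately show ?thesis by simp
      qed
      then show ?thesis using that[of m] i Suc by simp
    qed
    have "{c ! (Suc i mod n), c ! p} \<subseteq> E `` {c ! i}"
      using succ[OF i] succ[OF p(1)] p(2) E_symD by auto
    moreover have "card {c ! (Suc i mod n), c ! p} = 2"
    proof -
      have "Suc i mod n < n" using n3 by simp
      then have "c ! (Suc i mod n) \<noteq> c ! p"
        using c(1) p(1,3) by (simp add: n_def nth_eq_iff_index_eq)
      then show ?thesis by simp
    qed
    moreover have "card (E `` {c ! i}) = 2"
    proof (rule assms(2))
      show "c ! i \<in> V" using c(2) i nth_mem[of i c] by (auto simp: n_def)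
    qed
    ultimately have "{c ! (Suc i mod n), c ! p} = E `` {c ! i}"
      by (intro card_subset_eq) simp_all
    with p(1,2) show ?thesis by metis
  qed
  have idx: "\<exists>i<n. v = c ! i" if "v \<in> set c" for v
    using that by (metis in_set_conv_nth n_def)
  have closed: "v \<in> set c" if uv: "u \<in> set c" "(u, v) \<in> E" for u v
  proof -
    obtain i where i: "i < n" "u = c ! i" using idx[OF uv(1)] by blast
    obtain p where p: "p < n" "E `` {c ! i} = {c ! (Suc i mod n), c ! p}" using nb[OF i(1)] by blast
    have "Suc i mod n < n" using n3 by simp
    moreover have "v = c ! (Suc i mod n) \<or> v = c ! p" using uv(2) i(2) p(2) by blast
    ultimately show ?thesis using p(1) by (auto simp: n_def)
  qed
  have set_c: "set c = V"
  proof (rule ccontr)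
    assume "set c \<noteq> V"
    moreover have "set c \<noteq> {}" using c(3) by auto
    ultimately obtain a b where "a \<in> set c" "b \<notin> set c" "(a, b) \<in> E"
      using connE[OF assms(3) c(2)] by metis
    then show False using closed by blast
  qed
  have "E = symcl (set (zip c (rotate1 c)))"
  proof (intro subset_antisym subrelI)
    fix u v assume uv: "(u, v) \<in> E"
    then obtain i where i: "i < n" "u = c ! i" using idx[of u] set_c E_verts by blast
    obtain p where p: "p < n" "Suc p mod n = i" "E `` {c ! i} = {c ! (Suc i mod n), c ! p}"
      using nb[OF i(1)] by blast
    then have "v = c ! (Suc i mod n) \<or> v = c ! p" using uv i(2) by auto
    then show "(u, v) \<in> symcl (set (zip c (rotate1 c)))"
      unfolding in_symcl set_zip_rotate1 n_def[symmetric] using i p(1,2) by blast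
  next
    fix u v assume "(u, v) \<in> symcl (set (zip c (rotate1 c)))"
    then show "(u, v) \<in> E"
      unfolding in_symcl set_zip_rotate1 n_def[symmetric] using succ E_symD by blast
  qed
  then show thesis using that c(1,3) set_c by blast
qed

end

section \<open>Colouring cycles, graphs with a universal vertex, and wheels\<close>

lemma even_cycle_colouring:
  assumes "distinct c" "even (length c)"
  shows "\<exists>f. proper (symcl (set (zip c (rotate1 c)))) (set c) 2 f"
proof -
  define f where "f v = the_inv_into {..<length c} ((!) c) v mod 2" for v
  have "inj_on ((!) c) {..<length c}" using assms(1) by (simp add: inj_on_nth)
  then have f: "f (c ! i) = i mod 2" if "i < length c" for i
    using that by (simp add: f_def the_inv_into_f_f)
  have step: "f (c ! i) \<noteq> f (c ! (Suc i mod length c))" if "i < length c" for i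
  proof -
    \<comment> \<open>Even length makes the parity of the index consistent where the cycle closes
      up.\<close>
    have "Suc i mod length c mod 2 = Suc i mod 2" using assms(2) by (simp add: mod_mod_cancel)
    moreover have "Suc i mod length c < length c" using that by (intro mod_less_divisor) auto
    ultimately have "f (c ! (Suc i mod length c)) = Suc i mod 2" using f by simp
    then show ?thesis using f[OF that] by presburger
  qed
  have "proper (symcl (set (zip c (rotate1 c)))) (set c) 2 f"
    unfolding proper_def in_symcl set_zip_rotate1 using step by (auto simp: f_def) metis
  then show ?thesis by blast
qed

text \<open>Without \<open>h\<close>, all degrees are exactly \<open>k - 1\<close> and connectivity
  drops by at most one, so \<open>k - 1\<close> colours are sought. For \<open>k = 3\<close> what
  remains is a cycle, and only odd length is an obstruction.\<close>

lemma colouring_if_universal: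
  assumes "fin_sgraph V E" "3 \<le> k" "tight k V E" "h \<in> V"
    and univ: "\<And>v. v \<in> V \<Longrightarrow> v \<noteq> h \<Longrightarrow> (h, v) \<in> E"
    and deg: "\<And>v. v \<in> V \<Longrightarrow> v \<noteq> h \<Longrightarrow> card (E `` {v}) \<le> k"
    and "x \<in> V" "y \<in> V" "x \<noteq> y" "(x, y) \<notin> E"
  shows "(\<exists>f. proper E V k f) \<or>
    (\<exists>c. distinct c \<and> 3 \<le> length c \<and> odd (length c) \<and> h \<notin> set c \<and> V = insert h (set c) \<and>
      E = symcl (set (zip c (rotate1 c)) \<union> {h} \<times> set c))"
proof -
  interpret fin_sgraph V E by fact
  define W F where "W = V - {h}" and "F = E \<inter> W \<times> W"
  interpret H: fin_sgraph W F
    by unfold_locales (use fin_V irrefl_E in \<open>auto simp: W_def F_def sym_def irrefl_def dest: E_symD\<close>)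
  have V: "V = insert h W" "h \<notin> W" using assms(4) by (auto simp: W_def)
  have E: "(u, v) \<in> E \<longleftrightarrow> (u, v) \<in> F \<or> (u = h \<and> v \<in> W) \<or> (v = h \<and> u \<in> W)" for u v
    using univ[of u] univ[of v] E_symD[of u v] E_symD[of v u] E_verts[of u v] E_neq[of u v]
    by (auto simp: W_def F_def)
  have degF: "card (F `` {v}) = k - 1" if "v \<in> W" for v
  proof -
    have "E `` {v} = insert h (F `` {v})" using that V(2) E by auto
    moreover have "h \<notin> F `` {v}" using V(2) by (auto simp: F_def)
    ultimately have "card (E `` {v}) = Suc (card (F `` {v}))" by simp
    moreover have "card (E `` {v}) = k"
      using tightD(1)[OF assms(3), of v] deg[of v] that by (auto simp: W_def)
    ultimately show ?thesis by simp
  qed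
  have connF: "conn F (W - S)" if "S \<subseteq> W" "card S < k - 1" for S
  proof -
    have "finite S" using that(1) H.fin_V finite_subset by blast
    then have "card (insert h S) < k" using that(2) by (auto simp: card_insert_if)
    then have "conn E (V - insert h S)" using tightD(2)[OF assms(3)] that(1) V by blast
    moreover have "V - insert h S = W - S" by (auto simp: W_def)
    ultimately have "conn E (W - S)" by simp
    then show ?thesis by (rule conn_cong) (auto simp: F_def)
  qed
  have extend: "\<exists>f. proper E V k f" if "proper F W (k - 1) f" for f
  proof -
    have lt: "f v < k - 1" if "v \<in> W" for v
      using \<open>proper F W (k - 1) f\<close> that by (simp add: proper_def)
    have "proper E V k (f(h := k - 1))"
      unfolding proper_def
    proof (intro conjI ballI impI)
      fix v assume "v \<in> V"
      then show "(f(h := k - 1)) v < k" using lt[of v] assms(2) V by auto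
    next
      fix u v assume "u \<in> V" "v \<in> V" "(u, v) \<in> E"
      then show "(f(h := k - 1)) u \<noteq> (f(h := k - 1)) v"
        using lt[of u] lt[of v] V that E[of u v] H.E_neq[of u v] H.E_verts[of u v]
        by (auto simp: proper_def)
    qed
    then show ?thesis by blast
  qed
  have connW: "conn F W" using connF[of "{}"] assms(2) by simp
  have xy: "x \<in> W" "y \<in> W" using assms(7-10) univ E_symD by (auto simp: W_def)
  show ?thesis
  proof (cases "k = 3")
    case True
    have "W \<noteq> {}" using xy by blast
    moreover have "card (F `` {v}) = 2" if "v \<in> W" for v using degF[OF that] True by simp
    ultimately obtain c where c: "distinct c" "3 \<le> length c" "set c = W"
      "F = symcl (set (zip c (rotate1 c)))"
      using H.two_regular_cycle[OF _ _ connW] by metis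
    show ?thesis
    proof (cases "even (length c)")
      case even: True
      then obtain f where "proper F W 2 f"
        using even_cycle_colouring[OF c(1)] c(3,4) by auto
      then show ?thesis using extend True by simp
    next
      case False
      have "E = symcl (set (zip c (rotate1 c)) \<union> {h} \<times> set c)"
      proof (intro set_eqI)
        fix e :: "'a \<times> 'a"
        obtain u v where e: "e = (u, v)" by fastforce
        show "e \<in> E \<longleftrightarrow> e \<in> symcl (set (zip c (rotate1 c)) \<union> {h} \<times> set c)"
          unfolding e E c(4) in_symcl by (auto simp: c(3))
      qed
      then show ?thesis using c False V by blast
    qed
  next
    case False
    then have k4: "4 \<le> k" using assms(2) by simp
    have "insert x (F `` {x}) \<noteq> W" using xy assms(9,10) by (auto simp: F_def)
    moreover have "insert x (F `` {x}) \<subseteq> W" using xy H.E_sub by auto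
    ultimately obtain v w where vw: "v \<in> insert x (F `` {x})" "w \<in> W" "w \<notin> insert x (F `` {x})" "(v, w) \<in> F"
      using connE[OF connW] by (metis insert_not_empty)
    \<comment> \<open>This needs \<open>k \<ge> 4\<close>: for \<open>k = 3\<close>, deleting two
      vertices may disconnect the cycle.\<close>
    have "card {x, w} < k - 1" using k4 by (auto simp: card_insert_if)
    then have "\<exists>f. proper F W (k - 1) f"
      using vw xy(1) connF[of "{x, w}"] degF
      by (intro H.brooks_colouring[of v x w]) (auto dest: H.E_symD)
    then show ?thesis using extend by blast
  qed
qed

text \<open>The hub leaves two colours for the rim, so these alternate; odd length gives the first
  and last rim vertices, which are adjacent, the same colour.\<close>

lemma odd_wheel_not_3_colourable:
  assumes "distinct c" "3 \<le> length c" "odd (length c)"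
    and f: "\<And>u v. (u, v) \<in> symcl (set (zip c (rotate1 c)) \<union> {h} \<times> set c) \<Longrightarrow> f u \<noteq> f v"
    and range: "f ` insert h (set c) \<subseteq> {1..3::nat}"
  shows False
proof -
  have hub: "f (c ! i) \<noteq> f h" if "i < length c" for i
    using f[of "c ! i" h] that by (auto simp: in_symcl)
  have rim: "f (c ! i) \<noteq> f (c ! (Suc i mod length c))" if "i < length c" for i
    using f[of "c ! i" "c ! (Suc i mod length c)"] that
    by (auto simp: in_symcl set_zip_rotate1)
  have fh: "f h \<in> {1..3}" using range by blast
  have fc: "f (c ! i) \<in> {1..3}" if "i < length c" for i
    using range nth_mem[OF that] by blast
  have same: "f (c ! (2 * m)) = f (c ! 0)" if "2 * m < length c" for m
    using that
  proof (induction m)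
    case (Suc m)
    let ?i = "2 * m"
    have lt: "?i < length c" "Suc ?i < length c" "Suc (Suc ?i) < length c" using Suc.prems by auto
    have "f (c ! Suc (Suc ?i)) = f (c ! ?i)"
      using hub[OF lt(1)] hub[OF lt(2)] hub[OF lt(3)] rim[OF lt(1)] rim[OF lt(2)] lt
        fh fc[OF lt(1)] fc[OF lt(2)] fc[OF lt(3)] by auto
    then show ?case using Suc.IH lt(1) by simp
  qed simp
  obtain m where m: "length c = Suc (2 * m)" using assms(3) by (elim oddE) auto
  then show False using same[of m] rim[of "2 * m"] by simp
qed

text \<open>As every degree is at least \<open>k\<close>, this forces \<open>k = 3\<close> when the
  graph is an odd wheel.\<close>

lemma odd_wheel_rim_degree:
  assumes "distinct c" "3 \<le> length c" "h \<notin> set c"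
  shows "card (symcl (set (zip c (rotate1 c)) \<union> {h} \<times> set c) `` {c ! 0}) \<le> 3"
proof -
  let ?n = "length c"
  have index: "i = 0" if "i < ?n" "c ! 0 = c ! i" for i
  proof -
    have "0 < ?n" using that(1) by linarith
    from nth_eq_iff_index_eq[OF assms(1) this that(1)] that(2) show ?thesis by simp
  qed
  have "symcl (set (zip c (rotate1 c)) \<union> {h} \<times> set c) `` {c ! 0} \<subseteq>
      {c ! (Suc 0 mod ?n), c ! (?n - 1), h}"
  proof
    fix v assume "v \<in> symcl (set (zip c (rotate1 c)) \<union> {h} \<times> set c) `` {c ! 0}"
    then consider
        (next_rim) i where "i < ?n" "c ! 0 = c ! i" "v = c ! (Suc i mod ?n)"
      | (prev_rim) i where "i < ?n" "v = c ! i" "c ! 0 = c ! (Suc i mod ?n)"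
      | (is_hub) "c ! 0 = h" | (hub) "v = h"
      unfolding Image_singleton_iff in_symcl Un_iff set_zip_rotate1 by blast
    then show "v \<in> {c ! (Suc 0 mod ?n), c ! (?n - 1), h}"
    proof cases
      case (next_rim i)
      then show ?thesis using index[of i] by simp
    next
      case (prev_rim i)
      have "Suc i mod ?n < ?n" using prev_rim(1) by (intro mod_less_divisor) linarith
      with prev_rim(3) have "Suc i mod ?n = 0" using index by blast
      then have "i = ?n - 1" using prev_rim(1) by (cases "Suc i < ?n") auto
      then show ?thesis using prev_rim(2) by simp
    next
      case is_hub
      moreover have "c ! 0 \<in> set c" using assms(2) by (intro nth_mem) linarith
      ultimately show ?thesis using assms(3) by simp
    qed simp
  qed
  then have "card (symcl (set (zip c (rotate1 c)) \<union> {h} \<times> set c) `` {c ! 0}) \<le>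
      card {c ! (Suc 0 mod length c), c ! (length c - 1), h}"
    by (intro card_mono) auto
  also have "\<dots> \<le> 3" by (simp add: card_insert_if)
  finally show ?thesis .
qed

theorem theorem1p2:
  fixes k :: nat and G :: "'a pair_pre_digraph"
  assumes "k \<ge> 3"
    and "pair_graph G"
    and "k_connected k G"
    and "maximal_local_edge_connectivity k G"
  shows "k_colourable k G \<longleftrightarrow> \<not> complete_graph G \<and> \<not> odd_wheel G"
proof -
  let ?V = "pverts G" and ?E = "parcs G"
  have graph: "fin_sgraph ?V ?E" by (rule fin_sgraph_pair_graph[OF assms(2)])
  interpret fin_sgraph ?V ?E by (rule graph)
  have tight: "tight k ?V ?E" by (rule tight_pair_graph[OF assms(2-4)])
  have complete: "complete_graph G \<longleftrightarrow> (\<forall>x\<in>?V. \<forall>y\<in>?V. x \<noteq> y \<longrightarrow> (x, y) \<in> ?E)"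
    unfolding complete_graph_def complete_digraph_pair_def
    using fin_V by (auto dest: E_verts E_neq)
  have colourable: "k_colourable k G \<longleftrightarrow>
      (\<exists>f. f ` ?V \<subseteq> {1..k} \<and> (\<forall>u v. (u, v) \<in> ?E \<longrightarrow> f u \<noteq> f v))"
    unfolding k_colourable_def by (simp add: Ball_def split_paired_All)
  show ?thesis
  proof (intro iffI conjI notI)
    assume "k_colourable k G" "complete_graph G"
    then obtain f where f: "f ` ?V \<subseteq> {1..k}" "\<And>u v. (u, v) \<in> ?E \<Longrightarrow> f u \<noteq> f v"
      unfolding colourable by blast
    \<comment> \<open>A complete graph needs a colour per vertex, but minimum degree
      \<open>k\<close> demands more than \<open>k\<close> vertices.\<close>
    have "inj_on f ?V" using f(2) \<open>complete_graph G\<close> complete by (meson inj_onI)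
    then have "card ?V \<le> k" using card_inj_on_le[of f ?V "{1..k}"] f(1) by simp
    obtain v where v: "v \<in> ?V" using assms(3) by (force simp: k_connected_def)
    have "?E `` {v} \<subset> ?V" using v by (auto dest: E_verts E_neq)
    then have "card (?E `` {v}) < card ?V" by (rule psubset_card_mono[OF fin_V])
    then show False using tightD(1)[OF tight v] \<open>card ?V \<le> k\<close> by simp
  next
    assume "k_colourable k G" "odd_wheel G"
    then obtain f where f: "f ` ?V \<subseteq> {1..k}" "\<And>u v. (u, v) \<in> ?E \<Longrightarrow> f u \<noteq> f v"
      unfolding colourable by blast
    obtain c h where c: "distinct c" "3 \<le> length c" "odd (length c)" "h \<notin> set c"
      and G: "?V = insert h (set c)" "?E = symcl (set (zip c (rotate1 c)) \<union> {h} \<times> set c)"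
      using \<open>odd_wheel G\<close> by (auto simp: odd_wheel_def)
    have "c ! 0 \<in> ?V" using c(2) G(1) by (cases c) auto
    then have "k \<le> 3"
      using odd_wheel_rim_degree[OF c(1,2,4)] tightD(1)[OF tight] G(2) le_trans by metis
    then have "k = 3" using assms(1) by simp
    then show False using odd_wheel_not_3_colourable[OF c(1-3), of h f] f G by simp
  next
    assume not_exceptional: "\<not> complete_graph G \<and> \<not> odd_wheel G"
    then obtain x y where xy: "x \<in> ?V" "y \<in> ?V" "x \<noteq> y" "(x, y) \<notin> ?E"
      using complete by blast
    have "\<exists>f. proper ?E ?V k f"
    proof (rule ccontr)
      assume none: "\<not> ?thesis"
      then obtain h where h: "h \<in> ?V" "\<And>v. v \<in> ?V \<Longrightarrow> v \<noteq> h \<Longrightarrow> (h, v) \<in> ?E"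
        "\<And>v. v \<in> ?V \<Longrightarrow> v \<noteq> h \<Longrightarrow> card (?E `` {v}) \<le> k"
        using tight_colouring_or_universal[OF graph assms(1) tight] by blast
      from colouring_if_universal[OF graph assms(1) tight h xy] none
      have "odd_wheel G" unfolding odd_wheel_def by blast
      then show False using not_exceptional by blast
    qed
    then obtain f where f: "proper ?E ?V k f" by blast
    have "(\<lambda>v. f v + 1) ` ?V \<subseteq> {1..k}" using f by (auto simp: proper_def)
    moreover have "f u + 1 \<noteq> f v + 1" if "(u, v) \<in> ?E" for u v
      using f that E_verts by (auto simp: proper_def)
    ultimately show "k_colourable k G"
      unfolding colourable by (intro exI[of _ "\<lambda>v. f v + 1"]) auto
  qed
qed

end
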